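(* In the clustered-data framework described in the context, suppose that: (a) for all $\epsilon>0$, $\inf_{a\in\Theta:\ \|a-\theta\|\ge\epsilon}\mathbb{E}_\theta(\rho(X_{11},a))>\mathbb{E}_\theta(\rho(X_{11},\theta))$; (b) $\lim_{n\to\infty}\sum_{i=1}^n\Big(\frac{\sum_{j=1}^{m_i}w_{ij}}{N_n}\Big)=1$; (c) $\sup_{a\in\Theta}\mathbb{E}_\theta(|\rho(X_{11},a)|^{1+\delta})<\infty$ for some $\delta$ satisfying one of the following: (i) $\delta>0$ and $\lim_{n\to\infty}\sum_{i=1}^n\Big(\frac{\sum_{j=1}^{m_i}w_{ij}}{N_n}\Big)^{1+\delta}=0$; (ii) $\delta>1$, $\sum_{n\ge1}\sum_{i=1}^n\Big(\frac{\sum_{j=1}^{m_i}w_{ij}}{N_n}\Big)^{1+\delta}<\infty$, and $\sum_{n\ge1}\Big(\sum_{i=1}^n\Big(\frac{\sum_{j=1}^{m_i}w_{ij}}{N_n}\Big)^{2}\Big)^{s}<\infty$ for some $s>0$. Suppose moreover that there are $\lambda\in(0,1]$ and a measurable function $k:\mathbb{R}^d\to[0,\infty)$ such that, for all $x\in\mathbb{R}^d$ and all $a_1,a_2\in\Theta$, $$|\rho(x,a_1)-\rho(x,a_2)|\le k(x)\|a_1-a_2\|^{\lambda},$$ and $\mathbb{E}_\theta(k^{1+\delta}(X_{11}))<\infty$ with the same $\delta$ as in (c). Then, if (c)-(i) holds, $\widehat\theta_n^w\to\theta$ in probability as $n\to\infty$; and if (c)-(ii) holds, $\widehat\theta_n^w\to\theta$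 almost surely as $n\to\infty$.
   Context: Framework. $X_1,X_2,\dots$ are independent clusters; cluster $X_i$ consists of $m_i\ge1$ random variables $X_{i1},\dots,X_{im_i}$ with values in $\mathbb{R}^d$. All $X_{ij}$ have the same distribution $\mathbb{P}_\theta$, with $\theta\in\Theta\subset\mathbb{R}^d$, where $\Theta$ is a convex bounded set with non-empty interior; $\mathbb{E}_\theta$ denotes the corresponding expectation. Within each cluster $i$, $(X_{i1},X_{i2})$ and $(X_{ik},X_{ik'})$ have the same distribution for all $k\ne k'$ in $\{1,\dots,m_i\}$ (variables of the same cluster may be dependent). $N_n:=\sum_{i=1}^n m_i$ and $\lim_{n\to\infty}N_n/n=\ell\in[1,\infty)$. $\rho:\mathbb{R}^d\times\mathbb{R}^d\to\mathbb{R}$ is such that $x\mapsto\rho(x,a)$ is measurable for every $a\in\Theta$, and $\theta=\arg\min_{a\in\Theta}M(a)$ with $M(a):=\mathbb{E}_\theta(\rho(X_{11},a))$. The weights $w_{ij}$ are non-random positive numbers. The weighted M-estimator associated with $\rho$ is $$\widehat\theta_n^w=\arg\min_{a\in\Theta}M_n^w(a),\qquad M_n^w(a)=\frac1{N_n}\sum_{i=1}^n\sum_{j=1}^{m_i}w_{ij}\,\rho(X_{ij},a)$$ (a minimizer in $\Theta$, assumed to exist as a random vector). *)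

theory Defs
  imports "HOL-Probability.Probability"
begin

text \<open>
  Clusters and the variables inside a cluster are numbered from 1: the random variables are
  \<open>X i j\<close> with \<open>i \<ge> 1\<close> and \<open>1 \<le> j \<le> m i\<close>; values of \<open>X\<close>, \<open>m\<close> and \<open>w\<close> at other indices are
  irrelevant. \<open>M\<close> is the underlying probability space when the true parameter is \<open>\<theta>\<close>, so that
  \<open>\<int>\<omega>. f (X 1 1 \<omega>) \<partial>M\<close> is the expectation of \<open>f(X\<^sub>1\<^sub>1)\<close> under \<open>\<theta>\<close>.
\<close>

definition total_size :: "(nat \<Rightarrow> nat) \<Rightarrow> nat \<Rightarrow> nat" where
  "total_size m n = (\<Sum>i=1..n. m i)"

locale clustered_data = prob_space M
  for M :: "'w measure" +
  fixes P :: "real^'d \<Rightarrow> (real^'d) measure"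
    and \<Theta> :: "(real^'d) set"
    and \<theta> :: "real^'d"
    and m :: "nat \<Rightarrow> nat"
    and X :: "nat \<Rightarrow> nat \<Rightarrow> 'w \<Rightarrow> real^'d"
    and \<l> :: real
  assumes convex_Theta: "convex \<Theta>"
    and bounded_Theta: "bounded \<Theta>"
    and interior_Theta: "interior \<Theta> \<noteq> {}"
    and theta_in: "\<theta> \<in> \<Theta>"
    and cluster_nonempty: "\<And>i. i \<ge> 1 \<Longrightarrow> m i \<ge> 1"
    and X_measurable: "\<And>i j. i \<ge> 1 \<Longrightarrow> j \<in> {1..m i} \<Longrightarrow> X i j \<in> borel_measurable M"
    and clusters_indep:
      "indep_vars (\<lambda>i. Pi\<^sub>M {1..m i} (\<lambda>_. borel)) (\<lambda>i \<omega>. \<lambda>j\<in>{1..m i}. X i j \<omega>) {1..}"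
    and same_distr: "\<And>i j. i \<ge> 1 \<Longrightarrow> j \<in> {1..m i} \<Longrightarrow> distr M borel (X i j) = P \<theta>"
    and same_pair_distr:
      "\<And>i k k'. i \<ge> 1 \<Longrightarrow> k \<in> {1..m i} \<Longrightarrow> k' \<in> {1..m i} \<Longrightarrow> k \<noteq> k' \<Longrightarrow>
         distr M (borel \<Otimes>\<^sub>M borel) (\<lambda>\<omega>. (X i 1 \<omega>, X i 2 \<omega>)) =
         distr M (borel \<Otimes>\<^sub>M borel) (\<lambda>\<omega>. (X i k \<omega>, X i k' \<omega>))"
    and ell_ge_1: "\<l> \<ge> 1"
    and mean_size_tendsto: "(\<lambda>n. real (total_size m n) / real n) \<longlonglongrightarrow> \<l>"

definition cluster_weight :: "(nat \<Rightarrow> nat) \<Rightarrow> (nat \<Rightarrow> nat \<Rightarrow> real) \<Rightarrow> nat \<Rightarrow> nat \<Rightarrow> real" where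
  "cluster_weight m w n i = (\<Sum>j=1..m i. w i j) / real (total_size m n)"

definition weighted_criterion ::
  "(real^'d \<Rightarrow> real^'d \<Rightarrow> real) \<Rightarrow> (nat \<Rightarrow> nat) \<Rightarrow> (nat \<Rightarrow> nat \<Rightarrow> real) \<Rightarrow>
   (nat \<Rightarrow> nat \<Rightarrow> 'w \<Rightarrow> real^'d) \<Rightarrow> nat \<Rightarrow> 'w \<Rightarrow> real^'d \<Rightarrow> real" where
  "weighted_criterion \<rho> m w X n \<omega> a =
     (1 / real (total_size m n)) * (\<Sum>i=1..n. \<Sum>j=1..m i. w i j * \<rho> (X i j \<omega>) a)"

text \<open>No uniqueness of the minimizer is required, neither here nor for the true parameter.\<close>

definition weighted_M_estimator ::
  "'w measure \<Rightarrow> (real^'d) set \<Rightarrow> (real^'d \<Rightarrow> real^'d \<Rightarrow> real) \<Rightarrow> (nat \<Rightarrow> nat) \<Rightarrow>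
   (nat \<Rightarrow> nat \<Rightarrow> real) \<Rightarrow> (nat \<Rightarrow> nat \<Rightarrow> 'w \<Rightarrow> real^'d) \<Rightarrow> (nat \<Rightarrow> 'w \<Rightarrow> real^'d) \<Rightarrow> bool" where
  "weighted_M_estimator M \<Theta> \<rho> m w X T \<longleftrightarrow>
     (\<forall>n\<ge>1. T n \<in> borel_measurable M \<and>
        (\<forall>\<omega>\<in>space M. is_arg_min (weighted_criterion \<rho> m w X n \<omega>) (\<lambda>a. a \<in> \<Theta>) (T n \<omega>)))"

text \<open>
  In the two weight conditions the term of index \<open>n = 0\<close> of each series is 0 (empty inner sum),
  so summability over all naturals is summability over \<open>n \<ge> 1\<close>.
\<close>

definition weight_cond_i :: "(nat \<Rightarrow> nat) \<Rightarrow> (nat \<Rightarrow> nat \<Rightarrow> real) \<Rightarrow> real \<Rightarrow> bool" where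
  "weight_cond_i m w \<delta> \<longleftrightarrow>
     \<delta> > 0 \<and> (\<lambda>n. \<Sum>i=1..n. cluster_weight m w n i powr (1 + \<delta>)) \<longlonglongrightarrow> 0"

definition weight_cond_ii :: "(nat \<Rightarrow> nat) \<Rightarrow> (nat \<Rightarrow> nat \<Rightarrow> real) \<Rightarrow> real \<Rightarrow> bool" where
  "weight_cond_ii m w \<delta> \<longleftrightarrow>
     \<delta> > 1 \<and>
     summable (\<lambda>n. \<Sum>i=1..n. cluster_weight m w n i powr (1 + \<delta>)) \<and>
     (\<exists>s>0. summable (\<lambda>n. (\<Sum>i=1..n. (cluster_weight m w n i)\<^sup>2) powr s))"

definition tendsto_in_probability ::
  "'w measure \<Rightarrow> (nat \<Rightarrow> 'w \<Rightarrow> 'b::metric_space) \<Rightarrow> 'b \<Rightarrow> bool" where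
  "tendsto_in_probability M T c \<longleftrightarrow>
     (\<forall>\<epsilon>>0. (\<lambda>n. measure M {\<omega> \<in> space M. dist (T n \<omega>) c > \<epsilon>}) \<longlonglongrightarrow> 0)"

end

theory Submission
  imports Defs "HOL-Real_Asymp.Real_Asymp"
begin

text \<open>
  For a function \<open>f\<close> on the sample space put \<open>M\<^sub>n(f) = (1/N\<^sub>n) \<Sum>\<^sub>i \<Sum>\<^sub>j w\<^sub>i\<^sub>j f(X\<^sub>i\<^sub>j)\<close>, so that the criterion at
  \<open>a\<close> is \<open>M\<^sub>n(\<rho>(\<cdot>,a))\<close>. The dependence inside a cluster is removed by averaging over the cluster:
  \<open>M\<^sub>n(f) = \<Sum>\<^sub>i c\<^sub>n\<^sub>i Y\<^sub>i(f)\<close>, where \<open>c\<^sub>n\<^sub>i\<close> is the cluster weight and \<open>Y\<^sub>i(f)\<close> is a convex combination of the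
  \<open>f(X\<^sub>i\<^sub>j)\<close>. The \<open>Y\<^sub>i(f)\<close> are independent, all have mean \<open>E f(X\<^sub>1\<^sub>1)\<close>, and by Jensen's inequality inherit every
  convex moment bound of \<open>f(X\<^sub>1\<^sub>1)\<close> (lemma \<open>cluster_mean_convex_moment\<close>). Hence only a law of large numbers
  for triangular arrays of weighted independent variables is needed.

  Under condition (i) the largest weight vanishes, so \<open>\<Sum>\<^sub>i c\<^sub>n\<^sub>i\<^sup>2 \<rightarrow> 0\<close>. Truncating \<open>f\<close> at a high level, a variance
  bound for the bounded part and an \<open>L\<^sup>1\<close> bound for the tail give \<open>M\<^sub>n(f) \<rightarrow> E f(X\<^sub>1\<^sub>1)\<close> in \<open>L\<^sup>1\<close>
  (\<open>weighted_mean_L1_law\<close>). Under condition (ii) a Fuk-Nagaev type inequality bounds, for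
  large \<open>n\<close>, the probability that \<open>M\<^sub>n(f)\<close> deviates from its mean by a fixed amount by a multiple of
  \<open>\<Sum>\<^sub>i c\<^sub>n\<^sub>i\<^bsup>1+\<delta>\<^esup> + (\<Sum>\<^sub>i c\<^sub>n\<^sub>i\<^sup>2)\<^sup>s\<close>. This is summable in \<open>n\<close>, and the Borel-Cantelli lemma gives almost sure
  convergence (\<open>weighted_mean_strong_law\<close>).

  These laws are pointwise in \<open>a\<close>. They suffice because \<open>\<Theta>\<close> is totally bounded and both \<open>a \<mapsto> M\<^sub>n(\<rho>(\<cdot>,a))\<close> and its
  limit are Hoelder continuous, with constants \<open>M\<^sub>n(k)\<close> and \<open>E k(X\<^sub>1\<^sub>1)\<close>: closeness at the points of a finite
  net, together with closeness of \<open>M\<^sub>n(k)\<close> to \<open>E k(X\<^sub>1\<^sub>1)\<close>, is uniform closeness on \<open>\<Theta>\<close>, and then the separation of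
  \<open>\<theta>\<close> forces every minimizer near \<open>\<theta>\<close> (\<open>minimizer_near_of_finite_approximation\<close>). Consistency thus reduces to
  the law of large numbers for finitely many functions.
\<close>

section \<open>Elementary inequalities\<close>

text \<open>
  The linear term is exact, so that it disappears in expectations of centred variables; the upper bound
  \<open>b\<close> controls the rest of the series, however negative \<open>x\<close> may be.
\<close>
lemma exp_le_quadratic:
  fixes x b :: real
  assumes "x \<le> b" "0 \<le> b"
  shows "exp x \<le> 1 + x + x\<^sup>2 * exp b"
proof (cases "0 \<le> x")
  case True
  have step: "exp x - 1 \<le> x * exp x"
    using mult_right_mono[OF exp_ge_add_one_self[of "-x"], of "exp x"]
    by (simp add: algebra_simps flip: exp_add)
  have "exp x - 1 - x \<le> x * (exp x - 1)"
    using step by (simp add: algebra_simps)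
  also have "\<dots> \<le> x * (x * exp x)"
    using True step by (intro mult_left_mono)
  also have "\<dots> \<le> x\<^sup>2 * exp b"
    using assms by (simp add: power2_eq_square mult_left_mono flip: mult.assoc)
  finally show ?thesis by simp
next
  case False
  have "1 \<le> (1 + x + x\<^sup>2) * (1 - x)"
    using False by (simp add: algebra_simps power2_eq_square mult_nonpos_nonpos mult_le_0_iff)
  also have "\<dots> \<le> (1 + x + x\<^sup>2) * exp (-x)"
  proof (intro mult_left_mono)
    show "0 \<le> 1 + x + x\<^sup>2"
      using sum_power2_ge_zero[of "x + 1" x] zero_le_power2[of "x + 1/2"]
      by (simp add: power2_eq_square algebra_simps)
  qed (use exp_ge_add_one_self[of "-x"] in simp)
  finally have "exp x \<le> 1 + x + x\<^sup>2"
    by (simp add: exp_minus field_simps)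
  moreover have "x\<^sup>2 * 1 \<le> x\<^sup>2 * exp b"
    using assms by (intro mult_left_mono) auto
  ultimately show ?thesis by simp
qed

text \<open>
  Convexity of \<open>z \<mapsto> z powr p\<close> on the open half-line does not cover a vanishing argument; there it is replaced
  by \<open>s powr p \<le> s\<close> for \<open>0 < s < 1\<close>.
\<close>
lemma convex_on_abs_powr:
  fixes p :: real
  assumes "1 \<le> p"
  shows "convex_on UNIV (\<lambda>x::real. \<bar>x\<bar> powr p)"
proof (intro convex_onI)
  fix t x y :: real
  assume t: "0 < t" "t < 1"
  have shrink: "(s * \<bar>z\<bar>) powr p \<le> s * \<bar>z\<bar> powr p" if "0 < s" "s < 1" for s z :: real
  proof -
    have "s powr p \<le> s powr 1"
      using that assms by (intro powr_mono') auto
    then show ?thesis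
      using that by (simp add: powr_mult mult_right_mono)
  qed
  have "\<bar>(1 - t) *\<^sub>R x + t *\<^sub>R y\<bar> powr p \<le> ((1 - t) * \<bar>x\<bar> + t * \<bar>y\<bar>) powr p"
    using t assms abs_triangle_ineq[of "(1 - t) * x" "t * y"]
    by (intro powr_mono2) (auto simp: abs_mult)
  also have "\<dots> \<le> (1 - t) * \<bar>x\<bar> powr p + t * \<bar>y\<bar> powr p"
  proof (cases "x = 0 \<or> y = 0")
    case True
    then show ?thesis
      using t shrink[of t y] shrink[of "1 - t" x] by auto
  next
    case False
    then show ?thesis
      using convex_onD[OF powr_convex[OF assms], of t "\<bar>x\<bar>" "\<bar>y\<bar>"] t by simp
  qed
  finally show "\<bar>(1 - t) *\<^sub>R x + t *\<^sub>R y\<bar> powr p \<le> (1 - t) * \<bar>x\<bar> powr p + t * \<bar>y\<bar> powr p" .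
qed auto

text \<open>
  Used to pass from \<open>p\<close>-th moments of a variable to those of the centred variable.
\<close>
lemma abs_add_powr_le:
  fixes a b p :: real
  assumes "0 \<le> p"
  shows "\<bar>a + b\<bar> powr p \<le> 2 powr p * (\<bar>a\<bar> powr p + \<bar>b\<bar> powr p)"
proof -
  have "\<bar>a + b\<bar> powr p \<le> (2 * max \<bar>a\<bar> \<bar>b\<bar>) powr p"
    using assms by (intro powr_mono2) auto
  also have "\<dots> = 2 powr p * max \<bar>a\<bar> \<bar>b\<bar> powr p"
    by (simp add: powr_mult)
  also have "max \<bar>a\<bar> \<bar>b\<bar> powr p \<le> \<bar>a\<bar> powr p + \<bar>b\<bar> powr p"
    by (simp add: max_def)
  finally show ?thesis by simp
qed

lemma abs_powr_le_one_plus: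
  fixes x p q :: real
  assumes "0 \<le> q" "q \<le> p"
  shows "\<bar>x\<bar> powr q \<le> 1 + \<bar>x\<bar> powr p"
proof (cases "\<bar>x\<bar> \<le> 1")
  case True
  then have "\<bar>x\<bar> powr q \<le> 1"
    using assms powr_mono2[of q "\<bar>x\<bar>" 1] by simp
  then show ?thesis by (simp add: add_increasing2)
next
  case False
  then have "\<bar>x\<bar> powr q \<le> \<bar>x\<bar> powr p"
    using assms by (intro powr_mono) auto
  then show ?thesis by simp
qed

lemma (in prob_space) integrable_of_higher_moment:
  fixes Y :: "'a \<Rightarrow> real"
  assumes [measurable]: "random_variable borel Y"
    and "integrable M (\<lambda>\<omega>. \<bar>Y \<omega>\<bar> powr p)" "1 \<le> p"
  shows "integrable M Y"
proof (rule Bochner_Integration.integrable_bound)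
  show "integrable M (\<lambda>\<omega>. 1 + \<bar>Y \<omega>\<bar> powr p)"
    using assms by simp
  show "AE \<omega> in M. norm (Y \<omega>) \<le> norm (1 + \<bar>Y \<omega>\<bar> powr p)"
    using abs_powr_le_one_plus[of 1 p] assms(3) by (intro AE_I2) auto
qed measurable

lemma (in prob_space) square_integrable_of_higher_moment:
  fixes Y :: "'a \<Rightarrow> real"
  assumes [measurable]: "random_variable borel Y"
    and "integrable M (\<lambda>\<omega>. \<bar>Y \<omega>\<bar> powr p)" "2 \<le> p"
  shows "integrable M (\<lambda>\<omega>. (Y \<omega>)\<^sup>2)"
proof (rule Bochner_Integration.integrable_bound)
  show "integrable M (\<lambda>\<omega>. 1 + \<bar>Y \<omega>\<bar> powr p)"
    using assms by simp
  show "AE \<omega> in M. norm ((Y \<omega>)\<^sup>2) \<le> norm (1 + \<bar>Y \<omega>\<bar> powr p)"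
    using abs_powr_le_one_plus[of 2 p] assms(3) by (intro AE_I2) auto
qed measurable

section \<open>Sums of independent random variables\<close>

context prob_space begin

text \<open>
  Mixed products of independent centred variables have mean zero, so the second moments add up.
\<close>
lemma indep_sum_second_moment:
  fixes Z :: "'i \<Rightarrow> 'a \<Rightarrow> real"
  assumes "finite I" "indep_vars (\<lambda>_. borel) Z I"
    and "\<And>i. i \<in> I \<Longrightarrow> integrable M (\<lambda>\<omega>. (Z i \<omega>)\<^sup>2)"
    and "\<And>i. i \<in> I \<Longrightarrow> expectation (Z i) = 0"
  shows "integrable M (\<lambda>\<omega>. (\<Sum>i\<in>I. Z i \<omega>)\<^sup>2) \<and>
    expectation (\<lambda>\<omega>. (\<Sum>i\<in>I. Z i \<omega>)\<^sup>2) = (\<Sum>i\<in>I. expectation (\<lambda>\<omega>. (Z i \<omega>)\<^sup>2))"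
  using assms
proof (induction I rule: finite_induct)
  case (insert i I)
  have rv [measurable]: "random_variable borel (Z j)" if "j \<in> insert i I" for j
    using insert.prems(1) that unfolding indep_vars_def by blast
  have int: "integrable M (Z j)" if "j \<in> insert i I" for j
    using insert.prems(2) rv that by (blast intro: square_integrable_imp_integrable)
  have IH: "integrable M (\<lambda>\<omega>. (\<Sum>i\<in>I. Z i \<omega>)\<^sup>2)"
    "expectation (\<lambda>\<omega>. (\<Sum>i\<in>I. Z i \<omega>)\<^sup>2) = (\<Sum>i\<in>I. expectation (\<lambda>\<omega>. (Z i \<omega>)\<^sup>2))"
    using insert.IH insert.prems indep_vars_subset[OF insert.prems(1), of I] by auto
  have ind: "indep_var borel (Z i) borel (\<lambda>\<omega>. \<Sum>i\<in>I. Z i \<omega>)"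
    using insert by (intro indep_vars_sum) auto
  have intS: "integrable M (\<lambda>\<omega>. \<Sum>i\<in>I. Z i \<omega>)"
    using int by auto
  have cross: "integrable M (\<lambda>\<omega>. Z i \<omega> * (\<Sum>i\<in>I. Z i \<omega>))"
    "expectation (\<lambda>\<omega>. Z i \<omega> * (\<Sum>i\<in>I. Z i \<omega>)) = 0"
    using indep_var_integrable[OF ind int intS] indep_var_lebesgue_integral[OF ind int intS]
      insert.prems(3) by auto
  have "(\<Sum>j\<in>insert i I. Z j \<omega>)\<^sup>2 =
      (Z i \<omega>)\<^sup>2 + (\<Sum>i\<in>I. Z i \<omega>)\<^sup>2 + 2 * (Z i \<omega> * (\<Sum>i\<in>I. Z i \<omega>))" for \<omega>
    using insert.hyps by (simp add: power2_sum)
  then show ?case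
    using insert.hyps insert.prems(2) IH cross by simp
qed simp

text \<open>
  Truncation from above makes all exponential moments finite. It can only lower the mean, which is the
  favourable direction, and does not increase the second moment, so the quadratic bound of the exponential
  applies with the moments of \<open>Z\<close> itself.
\<close>
lemma truncated_mgf_le:
  fixes Z :: "'a \<Rightarrow> real"
  assumes [measurable]: "random_variable borel Z"
    and sq: "integrable M (\<lambda>\<omega>. (Z \<omega>)\<^sup>2)" and mean: "expectation Z = 0"
    and "0 \<le> h" "0 \<le> y"
  shows "integrable M (\<lambda>\<omega>. exp (h * min (Z \<omega>) y))"
    and "expectation (\<lambda>\<omega>. exp (h * min (Z \<omega>) y)) \<le>
      exp (h\<^sup>2 * exp (h * y) * expectation (\<lambda>\<omega>. (Z \<omega>)\<^sup>2))"
proof -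
  have int: "integrable M Z"
    using sq by (rule square_integrable_imp_integrable[rotated]) measurable
  have le: "h * min (Z \<omega>) y \<le> h * y" for \<omega>
    using assms by (intro mult_left_mono) auto
  show E: "integrable M (\<lambda>\<omega>. exp (h * min (Z \<omega>) y))"
    by (rule integrable_const_bound[where B = "exp (h * y)"]) (use le in auto)
  have "exp (h * min (Z \<omega>) y) \<le> 1 + h * Z \<omega> + h\<^sup>2 * exp (h * y) * (Z \<omega>)\<^sup>2" for \<omega>
  proof -
    have "exp (h * min (Z \<omega>) y) \<le>
        1 + h * min (Z \<omega>) y + (h * min (Z \<omega>) y)\<^sup>2 * exp (h * y)"
      using le assms by (intro exp_le_quadratic) auto
    moreover have "h * min (Z \<omega>) y \<le> h * Z \<omega>"
      using assms by (intro mult_left_mono) auto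
    moreover have "(min (Z \<omega>) y)\<^sup>2 \<le> (Z \<omega>)\<^sup>2"
      using assms by (intro abs_le_square_iff[THEN iffD1]) auto
    then have "(h * min (Z \<omega>) y)\<^sup>2 * exp (h * y) \<le> h\<^sup>2 * exp (h * y) * (Z \<omega>)\<^sup>2"
      by (simp add: power_mult_distrib mult_left_mono mult_ac)
    ultimately show ?thesis by linarith
  qed
  then have "expectation (\<lambda>\<omega>. exp (h * min (Z \<omega>) y)) \<le>
      expectation (\<lambda>\<omega>. 1 + h * Z \<omega> + h\<^sup>2 * exp (h * y) * (Z \<omega>)\<^sup>2)"
    using E int sq by (intro integral_mono) auto
  also have "\<dots> = 1 + h\<^sup>2 * exp (h * y) * expectation (\<lambda>\<omega>. (Z \<omega>)\<^sup>2)"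
    using int sq mean by (simp add: prob_space)
  also have "\<dots> \<le> exp (h\<^sup>2 * exp (h * y) * expectation (\<lambda>\<omega>. (Z \<omega>)\<^sup>2))"
    by (rule exp_ge_add_one_self)
  finally show "expectation (\<lambda>\<omega>. exp (h * min (Z \<omega>) y)) \<le>
      exp (h\<^sup>2 * exp (h * y) * expectation (\<lambda>\<omega>. (Z \<omega>)\<^sup>2))" .
qed

text \<open>
  The Fuk-Nagaev technique: unless some summand reaches \<open>y\<close>, the sum equals the sum of the truncated
  summands, to which Chernoff's bound applies. The level \<open>y\<close> and the exponent \<open>h\<close> are left free, to be tuned
  to the size of the variance.
\<close>
lemma indep_sum_upper_tail:
  fixes Z :: "'i \<Rightarrow> 'a \<Rightarrow> real"
  assumes fin: "finite I" and indep: "indep_vars (\<lambda>_. borel) Z I"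
    and sq: "\<And>i. i \<in> I \<Longrightarrow> integrable M (\<lambda>\<omega>. (Z i \<omega>)\<^sup>2)"
    and mean: "\<And>i. i \<in> I \<Longrightarrow> expectation (Z i) = 0"
    and h: "0 < h" and y: "0 \<le> y"
  shows "prob {\<omega>\<in>space M. x \<le> (\<Sum>i\<in>I. Z i \<omega>)} \<le>
    (\<Sum>i\<in>I. prob {\<omega>\<in>space M. y \<le> Z i \<omega>}) +
    exp (- h * x + h\<^sup>2 * exp (h * y) * (\<Sum>i\<in>I. expectation (\<lambda>\<omega>. (Z i \<omega>)\<^sup>2)))"
proof -
  have rv [measurable]: "random_variable borel (Z i)" if "i \<in> I" for i
    using indep that by (simp add: indep_vars_def)
  define E where "E = (\<lambda>i \<omega>. exp (h * min (Z i \<omega>) y))"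
  have indE: "indep_vars (\<lambda>_. borel) E I"
    unfolding E_def by (rule indep_vars_compose2[OF indep]) measurable
  have intE: "integrable M (E i)" if "i \<in> I" for i
    unfolding E_def using rv sq mean h y that by (intro truncated_mgf_le) auto
  have prod: "exp (h * (\<Sum>i\<in>I. min (Z i \<omega>) y)) = (\<Prod>i\<in>I. E i \<omega>)" for \<omega>
    using fin by (simp add: E_def sum_distrib_left exp_sum)
  have "prob {\<omega>\<in>space M. x \<le> (\<Sum>i\<in>I. min (Z i \<omega>) y)} \<le>
      exp (- h * x) * (\<integral>\<omega>\<in>space M. exp (h * (\<Sum>i\<in>I. min (Z i \<omega>) y)) \<partial>M)"
    unfolding prod[symmetric]
  proof (rule Chernoff_ineq_ge[OF h _ sets.top])
    show "set_integrable M (space M) (\<lambda>\<omega>. exp (h * (\<Sum>i\<in>I. min (Z i \<omega>) y)))"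
      unfolding prod set_integrable_def
      by (intro integrable_mult_indicator indep_vars_integrable[OF fin indE intE]) auto
  qed
  also have "(\<integral>\<omega>\<in>space M. exp (h * (\<Sum>i\<in>I. min (Z i \<omega>) y)) \<partial>M) = (\<Prod>i\<in>I. expectation (E i))"
    using indep_vars_lebesgue_integral[OF fin indE intE]
      set_integral_space[OF indep_vars_integrable[OF fin indE intE]]
    by (simp add: prod)
  also have "(\<Prod>i\<in>I. expectation (E i)) \<le>
      (\<Prod>i\<in>I. exp (h\<^sup>2 * exp (h * y) * expectation (\<lambda>\<omega>. (Z i \<omega>)\<^sup>2)))"
    unfolding E_def using rv sq mean h y by (intro prod_mono conjI truncated_mgf_le) auto
  also have "exp (- h * x) * \<dots> =
      exp (- h * x + h\<^sup>2 * exp (h * y) * (\<Sum>i\<in>I. expectation (\<lambda>\<omega>. (Z i \<omega>)\<^sup>2)))"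
    using fin by (simp add: exp_sum exp_add exp_diff exp_minus sum_distrib_left field_simps)
  finally have trunc: "prob {\<omega>\<in>space M. x \<le> (\<Sum>i\<in>I. min (Z i \<omega>) y)} \<le> \<dots>"
    by simp
  have "prob {\<omega>\<in>space M. x \<le> (\<Sum>i\<in>I. Z i \<omega>)} \<le>
      prob ({\<omega>\<in>space M. x \<le> (\<Sum>i\<in>I. min (Z i \<omega>) y)} \<union> (\<Union>i\<in>I. {\<omega>\<in>space M. y \<le> Z i \<omega>}))"
  proof (intro finite_measure_mono subsetI)
    fix \<omega> assume \<omega>: "\<omega> \<in> {\<omega>\<in>space M. x \<le> (\<Sum>i\<in>I. Z i \<omega>)}"
    show "\<omega> \<in> {\<omega>\<in>space M. x \<le> (\<Sum>i\<in>I. min (Z i \<omega>) y)} \<union> (\<Union>i\<in>I. {\<omega>\<in>space M. y \<le> Z i \<omega>})"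
    proof (cases "\<exists>i\<in>I. y \<le> Z i \<omega>")
      case False
      then have "(\<Sum>i\<in>I. min (Z i \<omega>) y) = (\<Sum>i\<in>I. Z i \<omega>)"
        by (intro sum.cong) auto
      then show ?thesis using \<omega> by simp
    qed (use \<omega> in auto)
  next
    have "{\<omega>\<in>space M. y \<le> Z i \<omega>} \<in> events" if "i \<in> I" for i
      using rv[OF that] by measurable
    moreover have "{\<omega>\<in>space M. x \<le> (\<Sum>i\<in>I. min (Z i \<omega>) y)} \<in> events"
      by measurable
    ultimately show "{\<omega>\<in>space M. x \<le> (\<Sum>i\<in>I. min (Z i \<omega>) y)} \<union>
        (\<Union>i\<in>I. {\<omega>\<in>space M. y \<le> Z i \<omega>}) \<in> events"
      using fin by (intro sets.Un sets.finite_UN)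
  qed
  also have "\<dots> \<le> prob {\<omega>\<in>space M. x \<le> (\<Sum>i\<in>I. min (Z i \<omega>) y)} +
      prob (\<Union>i\<in>I. {\<omega>\<in>space M. y \<le> Z i \<omega>})"
    using fin rv by (intro measure_Un_le) auto
  also have "prob (\<Union>i\<in>I. {\<omega>\<in>space M. y \<le> Z i \<omega>}) \<le> (\<Sum>i\<in>I. prob {\<omega>\<in>space M. y \<le> Z i \<omega>})"
    using fin rv by (intro finite_measure_subadditive_finite) auto
  finally show ?thesis using trunc by simp
qed

lemma indep_sum_abs_tail:
  fixes Z :: "'i \<Rightarrow> 'a \<Rightarrow> real"
  assumes fin: "finite I" and indep: "indep_vars (\<lambda>_. borel) Z I"
    and sq: "\<And>i. i \<in> I \<Longrightarrow> integrable M (\<lambda>\<omega>. (Z i \<omega>)\<^sup>2)"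
    and mean: "\<And>i. i \<in> I \<Longrightarrow> expectation (Z i) = 0"
    and h: "0 < h" and y: "0 \<le> y"
  shows "prob {\<omega>\<in>space M. x \<le> \<bar>\<Sum>i\<in>I. Z i \<omega>\<bar>} \<le>
    2 * (\<Sum>i\<in>I. prob {\<omega>\<in>space M. y \<le> \<bar>Z i \<omega>\<bar>}) +
    2 * exp (- h * x + h\<^sup>2 * exp (h * y) * (\<Sum>i\<in>I. expectation (\<lambda>\<omega>. (Z i \<omega>)\<^sup>2)))"
proof -
  have rv [measurable]: "random_variable borel (Z i)" if "i \<in> I" for i
    using indep that by (simp add: indep_vars_def)
  have "prob {\<omega>\<in>space M. x \<le> \<bar>\<Sum>i\<in>I. Z i \<omega>\<bar>} \<le>
      prob ({\<omega>\<in>space M. x \<le> (\<Sum>i\<in>I. Z i \<omega>)} \<union> {\<omega>\<in>space M. x \<le> (\<Sum>i\<in>I. - Z i \<omega>)})"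
    by (intro finite_measure_mono) (auto simp: sum_negf abs_real_def split: if_splits)
  also have "\<dots> \<le> prob {\<omega>\<in>space M. x \<le> (\<Sum>i\<in>I. Z i \<omega>)} +
      prob {\<omega>\<in>space M. x \<le> (\<Sum>i\<in>I. - Z i \<omega>)}"
    by (intro measure_Un_le) auto
  also have "prob {\<omega>\<in>space M. x \<le> (\<Sum>i\<in>I. Z i \<omega>)} \<le> (\<Sum>i\<in>I. prob {\<omega>\<in>space M. y \<le> Z i \<omega>}) +
      exp (- h * x + h\<^sup>2 * exp (h * y) * (\<Sum>i\<in>I. expectation (\<lambda>\<omega>. (Z i \<omega>)\<^sup>2)))"
    using assms by (rule indep_sum_upper_tail)
  also have "prob {\<omega>\<in>space M. x \<le> (\<Sum>i\<in>I. - Z i \<omega>)} \<le>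
      (\<Sum>i\<in>I. prob {\<omega>\<in>space M. y \<le> - Z i \<omega>}) +
      exp (- h * x + h\<^sup>2 * exp (h * y) * (\<Sum>i\<in>I. expectation (\<lambda>\<omega>. (- Z i \<omega>)\<^sup>2)))"
    using assms by (intro indep_sum_upper_tail indep_vars_compose2[OF indep, of "\<lambda>_ z. - z"]) auto
  also have "(\<Sum>i\<in>I. prob {\<omega>\<in>space M. y \<le> Z i \<omega>}) \<le> (\<Sum>i\<in>I. prob {\<omega>\<in>space M. y \<le> \<bar>Z i \<omega>\<bar>})"
    using rv by (intro sum_mono finite_measure_mono) auto
  also have "(\<Sum>i\<in>I. prob {\<omega>\<in>space M. y \<le> - Z i \<omega>}) \<le> (\<Sum>i\<in>I. prob {\<omega>\<in>space M. y \<le> \<bar>Z i \<omega>\<bar>})"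
    using rv by (intro sum_mono finite_measure_mono) auto
  finally show ?thesis by simp
qed

lemma AE_tendsto_of_AE_eventually_close:
  fixes Y :: "nat \<Rightarrow> 'a \<Rightarrow> 'b::metric_space"
  assumes "\<And>\<epsilon>. 0 < \<epsilon> \<Longrightarrow> AE \<omega> in M. eventually (\<lambda>n. dist (Y n \<omega>) c < \<epsilon>) sequentially"
  shows "AE \<omega> in M. (\<lambda>n. Y n \<omega>) \<longlonglongrightarrow> c"
proof -
  have "AE \<omega> in M. \<forall>j. eventually (\<lambda>n. dist (Y n \<omega>) c < inverse (real (Suc j))) sequentially"
    unfolding AE_all_countable by (intro allI assms) simp
  then show ?thesis
  proof eventually_elim
    case (elim \<omega>)
    show ?case
    proof (rule tendstoI)
      fix e :: real assume "0 < e"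
      then obtain j where j: "inverse (real (Suc j)) < e"
        using reals_Archimedean by blast
      show "eventually (\<lambda>n. dist (Y n \<omega>) c < e) sequentially"
        using elim[rule_format, of j] by eventually_elim (use j in linarith)
    qed
  qed
qed

text \<open>
  The deviation probabilities are summable, not merely small. Write \<open>B\<^sub>n = \<Sum>\<^sub>i c\<^sub>n\<^sub>i\<^sup>2\<close>. The truncation level
  \<open>y\<close> is a fixed fraction of the deviation \<open>x\<close>, so Markov's inequality bounds the probabilities of large
  summands by a multiple of \<open>\<Sum>\<^sub>i c\<^sub>n\<^sub>i\<^sup>p\<close>. The exponent \<open>h\<^sub>n = ln (1/B\<^sub>n) / (2y)\<close> grows slowly enough for the variance
  term of the Chernoff bound to vanish, while the main term \<open>exp (- h\<^sub>n x)\<close> becomes \<open>B\<^sub>n\<^bsup>x/(2y)\<^esup>\<close>. Any power of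
  \<open>B\<^sub>n\<close> can thus be reached, and \<open>y = x/(2s)\<close> gives the power \<open>s\<close>.
\<close>
lemma weighted_indep_sum_complete_convergence:
  fixes Y :: "nat \<Rightarrow> 'a \<Rightarrow> real" and c :: "nat \<Rightarrow> nat \<Rightarrow> real"
  assumes indep: "indep_vars (\<lambda>_. borel) Y {1..}"
    and mean: "\<And>i. 1 \<le> i \<Longrightarrow> expectation (Y i) = 0"
    and sq: "\<And>i. 1 \<le> i \<Longrightarrow> integrable M (\<lambda>\<omega>. (Y i \<omega>)\<^sup>2)"
    and sq_le: "\<And>i. 1 \<le> i \<Longrightarrow> expectation (\<lambda>\<omega>. (Y i \<omega>)\<^sup>2) \<le> v"
    and mom: "\<And>i. 1 \<le> i \<Longrightarrow> integrable M (\<lambda>\<omega>. \<bar>Y i \<omega>\<bar> powr p)"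
    and mom_le: "\<And>i. 1 \<le> i \<Longrightarrow> expectation (\<lambda>\<omega>. \<bar>Y i \<omega>\<bar> powr p) \<le> K"
    and p: "0 < p"
    and c: "\<And>n i. 1 \<le> i \<Longrightarrow> i \<le> n \<Longrightarrow> 0 < c n i"
    and sum_p: "summable (\<lambda>n. \<Sum>i=1..n. c n i powr p)"
    and s: "0 < s" and sum_s: "summable (\<lambda>n. (\<Sum>i=1..n. (c n i)\<^sup>2) powr s)"
  shows "AE \<omega> in M. (\<lambda>n. \<Sum>i=1..n. c n i * Y i \<omega>) \<longlonglongrightarrow> 0"
proof -
  have rv [measurable]: "random_variable borel (Y i)" if "1 \<le> i" for i
    using indep that by (simp add: indep_vars_def)
  have rv' [measurable]: "random_variable borel (\<lambda>\<omega>. \<Sum>i=1..n. c n i * Y i \<omega>)" for n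
    by (intro borel_measurable_sum borel_measurable_times borel_measurable_const rv) auto
  have v: "0 \<le> v"
    using sq_le[of 1] by (rule order_trans[rotated]) auto
  define B where "B = (\<lambda>n. \<Sum>i=1..n. (c n i)\<^sup>2)"
  have B_pos: "0 < B n" if "1 \<le> n" for n
    unfolding B_def using c[of _ n] that by (intro sum_pos) force+
  have "(\<lambda>n. (B n powr s) powr (1 / s)) \<longlonglongrightarrow> 0 powr (1 / s)"
    using summable_LIMSEQ_zero[OF sum_s[folded B_def]] s
    by (intro tendsto_powr2 tendsto_const) (auto simp: B_def)
  moreover have "(B n powr s) powr (1 / s) = B n" for n
    using s by (simp add: powr_powr B_def sum_nonneg)
  ultimately have B_lim: "B \<longlonglongrightarrow> 0" by simp
  have B_right: "filterlim B (at_right 0) sequentially"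
    using B_lim by (rule tendsto_imp_filterlim_at_right)
      (use B_pos in \<open>auto intro: eventually_sequentiallyI[of 1]\<close>)
  have conv: "AE \<omega> in M. eventually (\<lambda>n. \<bar>\<Sum>i=1..n. c n i * Y i \<omega>\<bar> < x) sequentially"
    if x: "0 < x" for x
  proof -
    define y where "y = x / (2 * s)"
    have y: "0 < y" using x s by (simp add: y_def)
    define h where "h = (\<lambda>n. - ln (B n) / (2 * y))"
    \<comment> \<open>The variance term: \<open>exp (h n * y)\<close> is \<open>B n\<close> to the power \<open>-1/2\<close>, against a variance of order \<open>B n\<close>.\<close>
    have "((\<lambda>b. (- ln b / (2 * y))\<^sup>2 * b powr (- 1 / 2) * (b * v)) \<longlongrightarrow> 0) (at_right 0)"
      using y by real_asymp
    then have "(\<lambda>n. (h n)\<^sup>2 * B n powr (- 1 / 2) * (B n * v)) \<longlonglongrightarrow> 0"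
      unfolding h_def by (rule filterlim_compose[OF _ B_right])
    then have ev1: "eventually (\<lambda>n. (h n)\<^sup>2 * B n powr (- 1 / 2) * (B n * v) < 1) sequentially"
      by (rule order_tendstoD) simp
    have ev2: "eventually (\<lambda>n. B n < 1) sequentially"
      using B_lim by (rule order_tendstoD) simp
    have bound: "eventually (\<lambda>n. prob {\<omega>\<in>space M. x \<le> \<bar>\<Sum>i=1..n. c n i * Y i \<omega>\<bar>} \<le>
        2 * (K / y powr p) * (\<Sum>i=1..n. c n i powr p) + 2 * exp 1 * B n powr s) sequentially"
      using ev1 ev2 eventually_ge_at_top[of 1]
    proof eventually_elim
      case (elim n)
      have Bn: "0 < B n" using B_pos elim by simp
      have hn: "0 < h n" using elim Bn y by (simp add: h_def divide_neg_pos)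
      have "prob {\<omega>\<in>space M. x \<le> \<bar>\<Sum>i=1..n. c n i * Y i \<omega>\<bar>} \<le>
          2 * (\<Sum>i=1..n. prob {\<omega>\<in>space M. y \<le> \<bar>c n i * Y i \<omega>\<bar>}) +
          2 * exp (- h n * x + (h n)\<^sup>2 * exp (h n * y) *
            (\<Sum>i=1..n. expectation (\<lambda>\<omega>. (c n i * Y i \<omega>)\<^sup>2)))"
        using sq mean hn y
        by (intro indep_sum_abs_tail indep_vars_compose2[OF indep_vars_subset[OF indep], of _ "\<lambda>i z. c n i * z"])
           (auto simp: power_mult_distrib)
      also have "(\<Sum>i=1..n. prob {\<omega>\<in>space M. y \<le> \<bar>c n i * Y i \<omega>\<bar>}) \<le>
          (\<Sum>i=1..n. c n i powr p * (K / y powr p))"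
      proof (intro sum_mono)
        fix i assume "i \<in> {1..n}"
        then have i: "1 \<le> i" and ci: "0 < c n i" using c[of i n] by auto
        have "prob {\<omega>\<in>space M. y \<le> \<bar>c n i * Y i \<omega>\<bar>} \<le>
            prob {\<omega>\<in>space M. y powr p \<le> \<bar>c n i * Y i \<omega>\<bar> powr p}"
          using rv[OF i] y p by (intro finite_measure_mono) (auto intro!: powr_mono2)
        also have "\<dots> \<le> expectation (\<lambda>\<omega>. \<bar>c n i * Y i \<omega>\<bar> powr p) / y powr p"
          using rv[OF i] mom[OF i] y
          by (intro integral_Markov_inequality_measure) (auto simp: abs_mult powr_mult)
        also have "\<dots> = c n i powr p * expectation (\<lambda>\<omega>. \<bar>Y i \<omega>\<bar> powr p) / y powr p"
          using ci by (simp add: abs_mult powr_mult)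
        also have "\<dots> \<le> c n i powr p * K / y powr p"
          using mom_le[OF i] by (intro divide_right_mono mult_left_mono) auto
        finally show "prob {\<omega>\<in>space M. y \<le> \<bar>c n i * Y i \<omega>\<bar>} \<le> c n i powr p * (K / y powr p)"
          by simp
      qed
      finally have "prob {\<omega>\<in>space M. x \<le> \<bar>\<Sum>i=1..n. c n i * Y i \<omega>\<bar>} \<le>
          2 * (\<Sum>i=1..n. c n i powr p * (K / y powr p)) +
          2 * exp (- h n * x + (h n)\<^sup>2 * exp (h n * y) *
            (\<Sum>i=1..n. expectation (\<lambda>\<omega>. (c n i * Y i \<omega>)\<^sup>2)))"
        by simp
      moreover have "exp (- h n * x + (h n)\<^sup>2 * exp (h n * y) *
          (\<Sum>i=1..n. expectation (\<lambda>\<omega>. (c n i * Y i \<omega>)\<^sup>2))) \<le> exp (s * ln (B n) + 1)"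
      proof (subst exp_le_cancel_iff, intro add_mono)
        show "- h n * x \<le> s * ln (B n)"
          using x s by (simp add: h_def y_def)
        have "(\<Sum>i=1..n. expectation (\<lambda>\<omega>. (c n i * Y i \<omega>)\<^sup>2)) \<le> B n * v"
          unfolding B_def sum_distrib_right using sq_le
          by (intro sum_mono) (auto simp: power_mult_distrib intro!: mult_left_mono)
        then have "(h n)\<^sup>2 * exp (h n * y) * (\<Sum>i=1..n. expectation (\<lambda>\<omega>. (c n i * Y i \<omega>)\<^sup>2)) \<le>
            (h n)\<^sup>2 * exp (h n * y) * (B n * v)"
          by (intro mult_left_mono) auto
        moreover have "exp (h n * y) = B n powr (- 1 / 2)"
          using y Bn by (simp add: h_def powr_def)
        ultimately show "(h n)\<^sup>2 * exp (h n * y) *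
            (\<Sum>i=1..n. expectation (\<lambda>\<omega>. (c n i * Y i \<omega>)\<^sup>2)) \<le> 1"
          using elim by simp
      qed
      moreover have "exp (s * ln (B n) + 1) = exp 1 * B n powr s"
        using Bn by (simp add: powr_def exp_add)
      ultimately show ?case
        by (simp add: sum_distrib_left sum_distrib_right mult_ac)
    qed
    have "summable (\<lambda>n. 2 * (K / y powr p) * (\<Sum>i=1..n. c n i powr p) + 2 * exp 1 * B n powr s)"
      using sum_p sum_s unfolding B_def by (intro summable_add summable_mult)
    then have "summable (\<lambda>n. prob {\<omega>\<in>space M. x \<le> \<bar>\<Sum>i=1..n. c n i * Y i \<omega>\<bar>})"
      by (rule summable_comparison_test_ev[rotated]) (use bound in simp)
    then have "AE \<omega> in M. eventually (\<lambda>n. \<omega> \<in> space M -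
        {\<omega>\<in>space M. x \<le> \<bar>\<Sum>i=1..n. c n i * Y i \<omega>\<bar>}) sequentially"
      by (intro borel_cantelli_AE1) (auto simp: emeasure_eq_measure)
    then show ?thesis
      by eventually_elim (auto elim!: eventually_mono)
  qed
  show ?thesis
    by (rule AE_tendsto_of_AE_eventually_close) (use conv in simp)
qed

end

section \<open>Laws of large numbers for weighted clusters\<close>

text \<open>
  The index 1 of the reference observation \<open>X 1 1\<close> must keep its form, so that facts about it apply after
  simplification.
\<close>
declare One_nat_def [simp del]

locale weighted_clusters = clustered_data M P \<Theta> \<theta> m X \<l>
  for M :: "'w measure" and P :: "real^'d \<Rightarrow> (real^'d) measure" and \<Theta> \<theta> m X \<l> +
  fixes w :: "nat \<Rightarrow> nat \<Rightarrow> real"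
  assumes weight_pos: "\<And>i j. 1 \<le> i \<Longrightarrow> j \<in> {1..m i} \<Longrightarrow> 0 < w i j"
begin

abbreviation population_mean :: "(real^'d \<Rightarrow> real) \<Rightarrow> real" where
  "population_mean f \<equiv> expectation (\<lambda>\<omega>. f (X 1 1 \<omega>))"

definition cluster_mean :: "(real^'d \<Rightarrow> real) \<Rightarrow> nat \<Rightarrow> 'w \<Rightarrow> real" where
  "cluster_mean f i \<omega> = (\<Sum>j=1..m i. w i j / (\<Sum>j=1..m i. w i j) * f (X i j \<omega>))"

definition weighted_mean :: "nat \<Rightarrow> (real^'d \<Rightarrow> real) \<Rightarrow> 'w \<Rightarrow> real" where
  "weighted_mean n f \<omega> = (\<Sum>i=1..n. cluster_weight m w n i * cluster_mean f i \<omega>)"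

lemma first_index: "1 \<in> {1..m 1}"
  using cluster_nonempty[of 1] by simp

lemma integrable_observation_iff:
  fixes f :: "real^'d \<Rightarrow> real"
  assumes "f \<in> borel_measurable borel" "1 \<le> i" "j \<in> {1..m i}"
  shows "integrable M (\<lambda>\<omega>. f (X i j \<omega>)) \<longleftrightarrow> integrable M (\<lambda>\<omega>. f (X 1 1 \<omega>))"
  using assms same_distr[of i j] same_distr[of 1 1] X_measurable[of i j] X_measurable[of 1 1] first_index
    integrable_distr_eq[of "X i j" M borel f] integrable_distr_eq[of "X 1 1" M borel f]
  by simp

lemma expectation_observation:
  fixes f :: "real^'d \<Rightarrow> real"
  assumes "f \<in> borel_measurable borel" "1 \<le> i" "j \<in> {1..m i}"
  shows "expectation (\<lambda>\<omega>. f (X i j \<omega>)) = population_mean f"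
  using assms same_distr[of i j] same_distr[of 1 1] X_measurable[of i j] X_measurable[of 1 1] first_index
    integral_distr[of "X i j" M borel f] integral_distr[of "X 1 1" M borel f]
  by simp

lemma weight_sum_pos:
  assumes "1 \<le> i"
  shows "0 < (\<Sum>j=1..m i. w i j)"
  using assms weight_pos cluster_nonempty[OF assms] by (intro sum_pos) auto

lemma normalized_weights_sum:
  assumes "1 \<le> i"
  shows "(\<Sum>j=1..m i. w i j / (\<Sum>j=1..m i. w i j)) = 1"
  using weight_sum_pos[OF assms] by (simp flip: sum_divide_distrib)

lemma normalized_weight_nonneg:
  assumes "1 \<le> i" "j \<in> {1..m i}"
  shows "0 \<le> w i j / (\<Sum>j=1..m i. w i j)"
  using weight_sum_pos[OF assms(1)] weight_pos[OF assms] by simp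

lemma cluster_weight_pos:
  assumes "1 \<le> i" "i \<le> n"
  shows "0 < cluster_weight m w n i"
proof -
  have "m i \<le> total_size m n"
    unfolding total_size_def using assms by (intro member_le_sum) auto
  then show ?thesis
    using weight_sum_pos[OF assms(1)] cluster_nonempty[OF assms(1)]
    by (simp add: cluster_weight_def)
qed

lemma cluster_weight_nonneg:
  assumes "i \<in> {1..n}"
  shows "0 \<le> cluster_weight m w n i"
  using cluster_weight_pos[of i n] assms by simp

lemma weighted_criterion_eq_weighted_mean:
  "weighted_criterion \<rho> m w X n \<omega> a = weighted_mean n (\<lambda>x. \<rho> x a) \<omega>"
  unfolding weighted_criterion_def weighted_mean_def
proof (subst sum_distrib_left, intro sum.cong refl)
  fix i assume "i \<in> {1..n}"
  then have "(\<Sum>j=1..m i. w i j) * cluster_mean (\<lambda>x. \<rho> x a) i \<omega> = (\<Sum>j=1..m i. w i j * \<rho> (X i j \<omega>) a)"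
    using weight_sum_pos[of i] unfolding cluster_mean_def
    by (subst sum_distrib_left, intro sum.cong) auto
  then show "1 / real (total_size m n) * (\<Sum>j=1..m i. w i j * \<rho> (X i j \<omega>) a) =
      cluster_weight m w n i * cluster_mean (\<lambda>x. \<rho> x a) i \<omega>"
    by (simp add: cluster_weight_def)
qed

lemma cluster_mean_mono:
  assumes "\<And>x. f x \<le> g x" "1 \<le> i"
  shows "cluster_mean f i \<omega> \<le> cluster_mean g i \<omega>"
  unfolding cluster_mean_def using assms normalized_weight_nonneg
  by (intro sum_mono mult_left_mono) auto

lemma cluster_mean_add:
  "cluster_mean (\<lambda>x. f x + g x) i \<omega> = cluster_mean f i \<omega> + cluster_mean g i \<omega>"
  by (simp add: cluster_mean_def distrib_left sum.distrib)

lemma cluster_mean_mult: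
  "cluster_mean (\<lambda>x. c * f x) i \<omega> = c * cluster_mean f i \<omega>"
  by (simp add: cluster_mean_def sum_distrib_left mult.left_commute)

lemma cluster_mean_diff_const:
  assumes "1 \<le> i"
  shows "cluster_mean (\<lambda>x. f x - c) i \<omega> = cluster_mean f i \<omega> - c"
  unfolding cluster_mean_def right_diff_distrib sum_subtractf
    sum_distrib_right[symmetric] normalized_weights_sum[OF assms] by simp

lemma convex_cluster_mean_le:
  assumes "convex_on UNIV \<phi>" "1 \<le> i"
  shows "\<phi> (cluster_mean f i \<omega>) \<le> cluster_mean (\<lambda>x. \<phi> (f x)) i \<omega>"
  using convex_on_sum[OF _ _ assms(1) normalized_weights_sum[OF assms(2)]
      normalized_weight_nonneg[OF assms(2)], of "\<lambda>j. f (X i j \<omega>)"]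
    cluster_nonempty[OF assms(2)]
  by (simp add: cluster_mean_def)

lemma cluster_mean_measurable:
  assumes [measurable]: "f \<in> borel_measurable borel" and i: "1 \<le> i"
  shows "cluster_mean f i \<in> borel_measurable M"
proof -
  have [measurable]: "X i j \<in> borel_measurable M" if "j \<in> {1..m i}" for j
    using X_measurable i that by blast
  show ?thesis
    unfolding cluster_mean_def by measurable
qed

lemma weighted_mean_measurable:
  assumes "f \<in> borel_measurable borel"
  shows "weighted_mean n f \<in> borel_measurable M"
  unfolding weighted_mean_def
  by (intro borel_measurable_sum borel_measurable_times borel_measurable_const
      cluster_mean_measurable assms) auto

text \<open>
  A cluster mean is a measurable function of its whole cluster, and it is whole clusters
  that are independent.
\<close>
lemma cluster_means_indep:
  assumes [measurable]: "f \<in> borel_measurable borel"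
  shows "indep_vars (\<lambda>_. borel) (cluster_mean f) {1..}"
proof -
  define G where "G i v = (\<Sum>j=1..m i. w i j / (\<Sum>j=1..m i. w i j) * f (v j))"
    for i and v :: "nat \<Rightarrow> real^'d"
  have "indep_vars (\<lambda>_. borel) (\<lambda>i \<omega>. G i (\<lambda>j\<in>{1..m i}. X i j \<omega>)) {1..}"
    by (rule indep_vars_compose2[OF clusters_indep]) (unfold G_def, measurable)
  moreover have "G i (\<lambda>j\<in>{1..m i}. X i j \<omega>) = cluster_mean f i \<omega>" for i \<omega>
    unfolding G_def cluster_mean_def by (intro sum.cong) auto
  ultimately show ?thesis by simp
qed

lemma cluster_mean_expectation:
  assumes f: "f \<in> borel_measurable borel" and int: "integrable M (\<lambda>\<omega>. f (X 1 1 \<omega>))" and i: "1 \<le> i"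
  shows "integrable M (cluster_mean f i)" and "expectation (cluster_mean f i) = population_mean f"
proof -
  have int': "integrable M (\<lambda>\<omega>. f (X i j \<omega>))" if "j \<in> {1..m i}" for j
    using integrable_observation_iff[OF f i that] int by simp
  show "integrable M (cluster_mean f i)"
    unfolding cluster_mean_def using int' by (intro Bochner_Integration.integrable_sum integrable_mult_right)
  have "expectation (cluster_mean f i) =
      (\<Sum>j=1..m i. w i j / (\<Sum>j=1..m i. w i j) * population_mean f)"
    unfolding cluster_mean_def using int' expectation_observation[OF f i]
    by (subst Bochner_Integration.integral_sum) auto
  then show "expectation (cluster_mean f i) = population_mean f"
    unfolding sum_distrib_right[symmetric] normalized_weights_sum[OF i] by simp
qed

text \<open>
  Jensen's inequality inside the cluster: the moment bound is the one of a single observation, uniformly in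
  the cluster and its size. It is applied with the absolute value, the square and the \<open>p\<close>-th power.
\<close>
lemma cluster_mean_convex_moment:
  fixes \<phi> :: "real \<Rightarrow> real"
  assumes \<phi>: "convex_on UNIV \<phi>" "\<And>x. 0 \<le> \<phi> x"
    and f [measurable]: "f \<in> borel_measurable borel"
    and int: "integrable M (\<lambda>\<omega>. \<phi> (f (X 1 1 \<omega>)))" and i: "1 \<le> i"
  shows "integrable M (\<lambda>\<omega>. \<phi> (cluster_mean f i \<omega>))"
    and "expectation (\<lambda>\<omega>. \<phi> (cluster_mean f i \<omega>)) \<le> population_mean (\<lambda>x. \<phi> (f x))"
proof -
  have meas: "(\<lambda>x. \<phi> (f x)) \<in> borel_measurable borel"
    using convex_measurable[OF f, of UNIV \<phi>] \<phi>(1) by simp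
  note E = cluster_mean_expectation[OF meas int i]
  show int': "integrable M (\<lambda>\<omega>. \<phi> (cluster_mean f i \<omega>))"
  proof (rule Bochner_Integration.integrable_bound[OF E(1)])
    show "(\<lambda>\<omega>. \<phi> (cluster_mean f i \<omega>)) \<in> borel_measurable M"
      using convex_measurable[OF cluster_mean_measurable[OF f i], of UNIV \<phi>] \<phi>(1) by simp
    show "AE \<omega> in M. norm (\<phi> (cluster_mean f i \<omega>)) \<le> norm (cluster_mean (\<lambda>x. \<phi> (f x)) i \<omega>)"
      using \<phi>(2) convex_cluster_mean_le[OF \<phi>(1) i, of f]
      by (intro AE_I2) (auto simp: abs_of_nonneg intro: order_trans[OF _ abs_ge_self])
  qed
  show "expectation (\<lambda>\<omega>. \<phi> (cluster_mean f i \<omega>)) \<le> population_mean (\<lambda>x. \<phi> (f x))"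
    unfolding E(2)[symmetric]
    using convex_cluster_mean_le[OF \<phi>(1) i, of f] by (intro integral_mono int' E(1))
qed

lemma weighted_mean_add:
  "weighted_mean n (\<lambda>x. f x + g x) \<omega> = weighted_mean n f \<omega> + weighted_mean n g \<omega>"
  by (simp add: weighted_mean_def cluster_mean_add distrib_left sum.distrib)

lemma weighted_mean_mult:
  "weighted_mean n (\<lambda>x. c * f x) \<omega> = c * weighted_mean n f \<omega>"
  by (simp add: weighted_mean_def cluster_mean_mult sum_distrib_left mult.left_commute)

lemma weighted_mean_mono:
  assumes "\<And>x. f x \<le> g x"
  shows "weighted_mean n f \<omega> \<le> weighted_mean n g \<omega>"
  unfolding weighted_mean_def
  by (intro sum_mono mult_left_mono cluster_mean_mono cluster_weight_nonneg assms) auto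

lemma weighted_mean_diff_const:
  "weighted_mean n (\<lambda>x. f x - c) \<omega> =
    weighted_mean n f \<omega> - (\<Sum>i=1..n. cluster_weight m w n i) * c"
  by (simp add: weighted_mean_def cluster_mean_diff_const right_diff_distrib sum_subtractf
      sum_distrib_right)

text \<open>
  The weighted mean is a positive linear functional; hence Hoelder continuity of \<open>\<rho>\<close> in the parameter with
  constant \<open>k x\<close> passes to the criterion with the random constant \<open>weighted_mean n k \<omega>\<close>.
\<close>
lemma weighted_mean_abs_diff_le:
  assumes "\<And>x. \<bar>f x - g x\<bar> \<le> c * h x"
  shows "\<bar>weighted_mean n f \<omega> - weighted_mean n g \<omega>\<bar> \<le> c * weighted_mean n h \<omega>"
proof -
  have "weighted_mean n f \<omega> \<le> weighted_mean n (\<lambda>x. g x + c * h x) \<omega>"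
    "weighted_mean n g \<omega> \<le> weighted_mean n (\<lambda>x. f x + c * h x) \<omega>"
    using assms by (intro weighted_mean_mono; smt (verit))+
  then show ?thesis
    by (simp add: weighted_mean_add weighted_mean_mult abs_le_iff)
qed

lemma integrable_weighted_mean:
  assumes "f \<in> borel_measurable borel" "integrable M (\<lambda>\<omega>. f (X 1 1 \<omega>))"
  shows "integrable M (weighted_mean n f)"
  unfolding weighted_mean_def using assms
  by (intro Bochner_Integration.integrable_sum integrable_mult_right cluster_mean_expectation) auto

lemma weighted_mean_L1_le:
  assumes f: "f \<in> borel_measurable borel" and int: "integrable M (\<lambda>\<omega>. f (X 1 1 \<omega>))"
  shows "expectation (\<lambda>\<omega>. \<bar>weighted_mean n f \<omega>\<bar>) \<le>
    (\<Sum>i=1..n. cluster_weight m w n i) * population_mean (\<lambda>x. \<bar>f x\<bar>)"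
proof -
  have abs: "convex_on UNIV (\<lambda>x::real. \<bar>x\<bar>)"
    using convex_on_abs_powr[of 1] by simp
  have int': "integrable M (\<lambda>\<omega>. \<bar>f (X 1 1 \<omega>)\<bar>)"
    using int by simp
  have "expectation (\<lambda>\<omega>. \<bar>weighted_mean n f \<omega>\<bar>) \<le>
      expectation (\<lambda>\<omega>. \<Sum>i=1..n. cluster_weight m w n i * \<bar>cluster_mean f i \<omega>\<bar>)"
  proof (intro integral_mono)
    show "integrable M (\<lambda>\<omega>. \<bar>weighted_mean n f \<omega>\<bar>)"
      using integrable_weighted_mean[OF f int] by simp
    show "integrable M (\<lambda>\<omega>. \<Sum>i=1..n. cluster_weight m w n i * \<bar>cluster_mean f i \<omega>\<bar>)"
      using cluster_mean_convex_moment(1)[OF abs _ f int'] by (intro Bochner_Integration.integrable_sum integrable_mult_right) auto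
    show "\<bar>weighted_mean n f \<omega>\<bar> \<le> (\<Sum>i=1..n. cluster_weight m w n i * \<bar>cluster_mean f i \<omega>\<bar>)" for \<omega>
      unfolding weighted_mean_def
      by (intro order_trans[OF sum_abs] sum_mono) (simp add: abs_mult cluster_weight_nonneg)
  qed
  also have "\<dots> = (\<Sum>i=1..n. cluster_weight m w n i * expectation (\<lambda>\<omega>. \<bar>cluster_mean f i \<omega>\<bar>))"
    using cluster_mean_convex_moment(1)[OF abs _ f int']
    by (subst Bochner_Integration.integral_sum) auto
  also have "\<dots> \<le> (\<Sum>i=1..n. cluster_weight m w n i * population_mean (\<lambda>x. \<bar>f x\<bar>))"
    using cluster_mean_convex_moment(2)[OF abs _ f int']
    by (intro sum_mono mult_left_mono cluster_weight_nonneg) auto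
  finally show ?thesis by (simp add: sum_distrib_right)
qed

lemma weighted_mean_centered_L1_le:
  assumes f: "f \<in> borel_measurable borel"
    and sq: "integrable M (\<lambda>\<omega>. (f (X 1 1 \<omega>))\<^sup>2)" and mean: "population_mean f = 0"
  shows "expectation (\<lambda>\<omega>. \<bar>weighted_mean n f \<omega>\<bar>) \<le>
    sqrt ((\<Sum>i=1..n. (cluster_weight m w n i)\<^sup>2) * population_mean (\<lambda>x. (f x)\<^sup>2))"
proof -
  have [measurable]: "X 1 1 \<in> borel_measurable M"
    using X_measurable first_index by blast
  have int: "integrable M (\<lambda>\<omega>. f (X 1 1 \<omega>))"
    by (rule square_integrable_imp_integrable[OF _ sq]) (use f in measurable)
  define Z where "Z = (\<lambda>i \<omega>. cluster_weight m w n i * cluster_mean f i \<omega>)"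
  have wm: "weighted_mean n f \<omega> = (\<Sum>i=1..n. Z i \<omega>)" for \<omega>
    by (simp add: weighted_mean_def Z_def)
  have Zsq: "integrable M (\<lambda>\<omega>. (Z i \<omega>)\<^sup>2)" if "i \<in> {1..n}" for i
    using cluster_mean_convex_moment(1)[OF convex_power2 _ f sq, of i] that
    by (simp add: Z_def power_mult_distrib)
  have Z0: "expectation (Z i) = 0" if "i \<in> {1..n}" for i
    using cluster_mean_expectation(2)[OF f int, of i] that mean by (simp add: Z_def)
  have indep: "indep_vars (\<lambda>_. borel) Z {1..n}"
    unfolding Z_def
    by (rule indep_vars_compose2[OF indep_vars_subset[OF cluster_means_indep[OF f]]]) auto
  note second = indep_sum_second_moment[OF finite_atLeastAtMost indep Zsq Z0]
  have "(expectation (\<lambda>\<omega>. \<bar>weighted_mean n f \<omega>\<bar>))\<^sup>2 \<le> expectation (\<lambda>\<omega>. (weighted_mean n f \<omega>)\<^sup>2)"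
    using variance_positive[of "\<lambda>\<omega>. \<bar>weighted_mean n f \<omega>\<bar>"] second
      integrable_abs[OF integrable_weighted_mean[OF f int, of n]]
    by (subst (asm) variance_eq) (auto simp: wm)
  also have "\<dots> = (\<Sum>i=1..n. expectation (\<lambda>\<omega>. (Z i \<omega>)\<^sup>2))"
    using second by (simp add: wm)
  also have "\<dots> \<le> (\<Sum>i=1..n. (cluster_weight m w n i)\<^sup>2 * population_mean (\<lambda>x. (f x)\<^sup>2))"
    using cluster_mean_convex_moment(2)[OF convex_power2 _ f sq]
    by (intro sum_mono) (auto simp: Z_def power_mult_distrib intro!: mult_left_mono)
  finally show ?thesis
    by (intro real_le_rsqrt) (simp add: sum_distrib_right)
qed

text \<open>
  No second moment is available, so \<open>f\<close> is split at a level \<open>b\<close> into a bounded part \<open>g b\<close> and a tail \<open>r b\<close>, both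
  centred. The variance bound makes the bounded part negligible as \<open>n\<close> grows with \<open>b\<close> fixed. The tail costs at
  most about twice its \<open>L\<^sup>1\<close> norm for every \<open>n\<close>, which is small if \<open>b\<close> is large. A third contribution comes from
  the total weight, which is only asymptotically 1.
\<close>
lemma weighted_mean_L1_law:
  assumes total: "(\<lambda>n. \<Sum>i=1..n. cluster_weight m w n i) \<longlonglongrightarrow> 1"
    and squares: "(\<lambda>n. \<Sum>i=1..n. (cluster_weight m w n i)\<^sup>2) \<longlonglongrightarrow> 0"
    and f [measurable]: "f \<in> borel_measurable borel" and int: "integrable M (\<lambda>\<omega>. f (X 1 1 \<omega>))"
  shows "(\<lambda>n. expectation (\<lambda>\<omega>. \<bar>weighted_mean n f \<omega> - population_mean f\<bar>)) \<longlonglongrightarrow> 0"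
proof -
  have X11 [measurable]: "X 1 1 \<in> borel_measurable M"
    using X_measurable first_index by blast
  define C where "C n = (\<Sum>i=1..n. cluster_weight m w n i)" for n
  define Q where "Q n = (\<Sum>i=1..n. (cluster_weight m w n i)\<^sup>2)" for n
  define g where "g b x = (if \<bar>f x\<bar> \<le> real b then f x else 0)" for b x
  define r where "r b x = (if \<bar>f x\<bar> \<le> real b then 0 else f x)" for b x
  have gr [measurable]: "g b \<in> borel_measurable borel" "r b \<in> borel_measurable borel" for b
    unfolding g_def r_def by measurable
  have g_le: "\<bar>g b x\<bar> \<le> real b" and r_le: "\<bar>r b x\<bar> \<le> \<bar>f x\<bar>" and fgr: "f x = g b x + r b x" for b x
    by (auto simp: g_def r_def)
  have int_g: "integrable M (\<lambda>\<omega>. g b (X 1 1 \<omega>))" for b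
    using g_le by (intro integrable_const_bound[where B = "real b"]) auto
  have int_r: "integrable M (\<lambda>\<omega>. r b (X 1 1 \<omega>))" for b
    using r_le by (intro Bochner_Integration.integrable_bound[OF int]) auto
  define V where "V b = population_mean (\<lambda>x. (g b x - population_mean (g b))\<^sup>2)" for b
  have mean_fgr: "population_mean f = population_mean (g b) + population_mean (r b)" for b
    unfolding fgr[of _ b] using int_g int_r by simp
  have bound: "expectation (\<lambda>\<omega>. \<bar>weighted_mean n f \<omega> - population_mean f\<bar>) \<le>
      sqrt (Q n * V b) + C n * (2 * population_mean (\<lambda>x. \<bar>r b x\<bar>)) + \<bar>C n - 1\<bar> * \<bar>population_mean f\<bar>" for n b
  proof -
    let ?g = "\<lambda>x. g b x - population_mean (g b)" and ?r = "\<lambda>x. r b x - population_mean (r b)"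
    have int_g': "integrable M (\<lambda>\<omega>. ?g (X 1 1 \<omega>))" and int_r': "integrable M (\<lambda>\<omega>. ?r (X 1 1 \<omega>))"
      using int_g int_r by auto
    have "weighted_mean n f \<omega> = weighted_mean n (g b) \<omega> + weighted_mean n (r b) \<omega>" for \<omega>
      using weighted_mean_add[of n "g b" "r b" \<omega>] by (simp flip: fgr)
    then have split: "weighted_mean n f \<omega> - population_mean f =
        weighted_mean n ?g \<omega> + weighted_mean n ?r \<omega> + (C n - 1) * population_mean f" for \<omega>
      by (simp add: weighted_mean_diff_const mean_fgr[of b] C_def algebra_simps)
    have "expectation (\<lambda>\<omega>. \<bar>weighted_mean n f \<omega> - population_mean f\<bar>) \<le>
        expectation (\<lambda>\<omega>. \<bar>weighted_mean n ?g \<omega>\<bar> + \<bar>weighted_mean n ?r \<omega>\<bar> + \<bar>C n - 1\<bar> * \<bar>population_mean f\<bar>)"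
      using integrable_weighted_mean[OF f int, of n] integrable_weighted_mean[OF _ int_g', of n]
        integrable_weighted_mean[OF _ int_r', of n]
      by (intro integral_mono) (auto simp: split abs_mult[symmetric])
    also have "\<dots> = expectation (\<lambda>\<omega>. \<bar>weighted_mean n ?g \<omega>\<bar>) +
        expectation (\<lambda>\<omega>. \<bar>weighted_mean n ?r \<omega>\<bar>) + \<bar>C n - 1\<bar> * \<bar>population_mean f\<bar>"
      using integrable_weighted_mean[OF _ int_g', of n] integrable_weighted_mean[OF _ int_r', of n]
      by (simp add: prob_space)
    also have "expectation (\<lambda>\<omega>. \<bar>weighted_mean n ?g \<omega>\<bar>) \<le> sqrt (Q n * V b)"
      unfolding Q_def V_def
    proof (rule weighted_mean_centered_L1_le)
      have "\<bar>population_mean (g b)\<bar> \<le> real b"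
        using int_g[of b] g_le[of b]
          integral_mono[of M "\<lambda>\<omega>. \<bar>g b (X 1 1 \<omega>)\<bar>" "\<lambda>_. real b"]
        by (intro order_trans[OF integral_abs_bound]) (simp add: prob_space)
      then have "\<bar>?g x\<bar> \<le> 2 * real b" for x
        using g_le[of b x] by linarith
      then have "\<bar>(?g x)\<^sup>2\<bar> \<le> (2 * real b)\<^sup>2" for x
        using abs_le_square_iff[of "?g x" "2 * real b"] by simp
      then show "integrable M (\<lambda>\<omega>. (?g (X 1 1 \<omega>))\<^sup>2)"
        by (intro integrable_const_bound[where B = "(2 * real b)\<^sup>2"]) auto
    qed (use int_g in \<open>auto simp: prob_space\<close>)
    also have "expectation (\<lambda>\<omega>. \<bar>weighted_mean n ?r \<omega>\<bar>) \<le> C n * population_mean (\<lambda>x. \<bar>?r x\<bar>)"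
      unfolding C_def using int_r' by (intro weighted_mean_L1_le) auto
    also have "C n * population_mean (\<lambda>x. \<bar>?r x\<bar>) \<le> C n * (2 * population_mean (\<lambda>x. \<bar>r b x\<bar>))"
    proof (rule mult_left_mono)
      have "population_mean (\<lambda>x. \<bar>?r x\<bar>) \<le>
          population_mean (\<lambda>x. \<bar>r b x\<bar> + \<bar>population_mean (r b)\<bar>)"
        using int_r' int_r by (intro integral_mono) auto
      also have "\<dots> \<le> 2 * population_mean (\<lambda>x. \<bar>r b x\<bar>)"
        using int_r[of b] integral_abs_bound[of M "\<lambda>\<omega>. r b (X 1 1 \<omega>)"] by (simp add: prob_space)
      finally show "population_mean (\<lambda>x. \<bar>?r x\<bar>) \<le> 2 * population_mean (\<lambda>x. \<bar>r b x\<bar>)" .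
      show "0 \<le> C n"
        unfolding C_def by (intro sum_nonneg cluster_weight_nonneg)
    qed
    finally show ?thesis by simp
  qed
  have tail: "(\<lambda>b. population_mean (\<lambda>x. \<bar>r b x\<bar>)) \<longlonglongrightarrow> expectation (\<lambda>\<omega>. 0)"
  proof (rule integral_dominated_convergence[where w = "\<lambda>\<omega>. \<bar>f (X 1 1 \<omega>)\<bar>"])
    have "(\<lambda>b. \<bar>r b x\<bar>) \<longlonglongrightarrow> 0" for x
    proof (rule tendsto_eventually)
      obtain b0 where "\<bar>f x\<bar> \<le> real b0" using real_arch_simple by blast
      then show "eventually (\<lambda>b. \<bar>r b x\<bar> = 0) sequentially"
        by (intro eventually_sequentiallyI[of b0]) (auto simp: r_def)
    qed
    then show "AE \<omega> in M. (\<lambda>b. \<bar>r b (X 1 1 \<omega>)\<bar>) \<longlonglongrightarrow> 0" by simp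
  qed (use int r_le in auto)
  show ?thesis
  proof (rule tendstoI)
    fix \<epsilon> :: real assume \<epsilon>: "0 < \<epsilon>"
    then have "eventually (\<lambda>b. population_mean (\<lambda>x. \<bar>r b x\<bar>) < \<epsilon> / 2) sequentially"
      using tail by (intro order_tendstoD) auto
    then obtain b where b: "population_mean (\<lambda>x. \<bar>r b x\<bar>) < \<epsilon> / 2"
      by (auto simp: eventually_sequentially)
    have "(\<lambda>n. sqrt (Q n * V b) + C n * (2 * population_mean (\<lambda>x. \<bar>r b x\<bar>)) +
        \<bar>C n - 1\<bar> * \<bar>population_mean f\<bar>) \<longlonglongrightarrow>
        sqrt (0 * V b) + 1 * (2 * population_mean (\<lambda>x. \<bar>r b x\<bar>)) + \<bar>1 - 1\<bar> * \<bar>population_mean f\<bar>"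
      using total squares unfolding C_def Q_def by (intro tendsto_intros)
    then have "eventually (\<lambda>n. sqrt (Q n * V b) + C n * (2 * population_mean (\<lambda>x. \<bar>r b x\<bar>)) +
        \<bar>C n - 1\<bar> * \<bar>population_mean f\<bar> < \<epsilon>) sequentially"
      by (rule order_tendstoD) (use b in simp)
    then show "eventually (\<lambda>n. dist (expectation (\<lambda>\<omega>. \<bar>weighted_mean n f \<omega> - population_mean f\<bar>)) 0 < \<epsilon>) sequentially"
      by eventually_elim (use bound[of _ b] in \<open>auto intro: le_less_trans\<close>)
  qed
qed

lemma weighted_mean_prob_law:
  assumes "(\<lambda>n. \<Sum>i=1..n. cluster_weight m w n i) \<longlonglongrightarrow> 1"
    and "(\<lambda>n. \<Sum>i=1..n. (cluster_weight m w n i)\<^sup>2) \<longlonglongrightarrow> 0"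
    and f: "f \<in> borel_measurable borel" and int: "integrable M (\<lambda>\<omega>. f (X 1 1 \<omega>))"
    and \<tau>: "0 < \<tau>"
  shows "(\<lambda>n. prob {\<omega>\<in>space M. \<tau> \<le> \<bar>weighted_mean n f \<omega> - population_mean f\<bar>}) \<longlonglongrightarrow> 0"
proof (rule tendsto_sandwich)
  show "(\<lambda>_. 0) \<longlonglongrightarrow> (0::real)" by simp
  show "(\<lambda>n. expectation (\<lambda>\<omega>. \<bar>weighted_mean n f \<omega> - population_mean f\<bar>) / \<tau>) \<longlonglongrightarrow> 0"
    using tendsto_divide[OF weighted_mean_L1_law[OF assms(1-4)] tendsto_const[of \<tau>]] \<tau> by simp
  show "eventually (\<lambda>n. prob {\<omega>\<in>space M. \<tau> \<le> \<bar>weighted_mean n f \<omega> - population_mean f\<bar>} \<le>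
      expectation (\<lambda>\<omega>. \<bar>weighted_mean n f \<omega> - population_mean f\<bar>) / \<tau>) sequentially"
    using integrable_weighted_mean[OF f int] \<tau>
    by (intro always_eventually allI integral_Markov_inequality_measure[where A = "{}"]) auto
qed auto

text \<open>
  The general theorem on independent sums is applied to the cluster means of the centred function
  \<open>f - E f\<close>; the total weight tending to 1 restores the mean.
\<close>
lemma weighted_mean_strong_law:
  assumes total: "(\<lambda>n. \<Sum>i=1..n. cluster_weight m w n i) \<longlonglongrightarrow> 1"
    and p: "2 \<le> p" and sum_p: "summable (\<lambda>n. \<Sum>i=1..n. cluster_weight m w n i powr p)"
    and s: "0 < s" and sum_s: "summable (\<lambda>n. (\<Sum>i=1..n. (cluster_weight m w n i)\<^sup>2) powr s)"
    and f [measurable]: "f \<in> borel_measurable borel"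
    and mom: "integrable M (\<lambda>\<omega>. \<bar>f (X 1 1 \<omega>)\<bar> powr p)"
  shows "AE \<omega> in M. (\<lambda>n. weighted_mean n f \<omega>) \<longlonglongrightarrow> population_mean f"
proof -
  have [measurable]: "X 1 1 \<in> borel_measurable M"
    using X_measurable first_index by blast
  have int: "integrable M (\<lambda>\<omega>. f (X 1 1 \<omega>))"
    by (rule integrable_of_higher_moment[OF _ mom]) (use p in auto)
  define g where "g x = f x - population_mean f" for x
  have g [measurable]: "g \<in> borel_measurable borel"
    unfolding g_def by measurable
  have mom_g: "integrable M (\<lambda>\<omega>. \<bar>g (X 1 1 \<omega>)\<bar> powr p)"
  proof (rule Bochner_Integration.integrable_bound)
    show "integrable M (\<lambda>\<omega>. 2 powr p * (\<bar>f (X 1 1 \<omega>)\<bar> powr p + \<bar>population_mean f\<bar> powr p))"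
      using mom by simp
    show "AE \<omega> in M. norm (\<bar>g (X 1 1 \<omega>)\<bar> powr p) \<le>
        norm (2 powr p * (\<bar>f (X 1 1 \<omega>)\<bar> powr p + \<bar>population_mean f\<bar> powr p))"
      using p abs_add_powr_le[of p "f _" "- population_mean f"] by (intro AE_I2) (simp add: g_def)
  qed measurable
  have sq_g: "integrable M (\<lambda>\<omega>. (g (X 1 1 \<omega>))\<^sup>2)"
    by (rule square_integrable_of_higher_moment[OF _ mom_g p]) measurable
  have int_g: "integrable M (\<lambda>\<omega>. g (X 1 1 \<omega>))"
    unfolding g_def using int by simp
  have mean_g: "population_mean g = 0"
    unfolding g_def using int by (simp add: prob_space)
  have "AE \<omega> in M. (\<lambda>n. \<Sum>i=1..n. cluster_weight m w n i * cluster_mean g i \<omega>) \<longlonglongrightarrow> 0"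
  proof (rule weighted_indep_sum_complete_convergence)
    show "indep_vars (\<lambda>_. borel) (cluster_mean g) {1..}"
      using g by (rule cluster_means_indep)
    fix i :: nat assume i: "1 \<le> i"
    show "expectation (cluster_mean g i) = 0"
      using cluster_mean_expectation[OF g int_g i] mean_g by simp
    show "integrable M (\<lambda>\<omega>. (cluster_mean g i \<omega>)\<^sup>2)"
      "expectation (\<lambda>\<omega>. (cluster_mean g i \<omega>)\<^sup>2) \<le> population_mean (\<lambda>x. (g x)\<^sup>2)"
      using cluster_mean_convex_moment[OF convex_power2 _ g sq_g i] by auto
    show "integrable M (\<lambda>\<omega>. \<bar>cluster_mean g i \<omega>\<bar> powr p)"
      "expectation (\<lambda>\<omega>. \<bar>cluster_mean g i \<omega>\<bar> powr p) \<le> population_mean (\<lambda>x. \<bar>g x\<bar> powr p)"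
      using cluster_mean_convex_moment[OF convex_on_abs_powr _ g mom_g i] p by auto
  qed (use p s sum_p sum_s cluster_weight_pos in auto)
  then show ?thesis
  proof eventually_elim
    case (elim \<omega>)
    then have "(\<lambda>n. weighted_mean n g \<omega> + (\<Sum>i=1..n. cluster_weight m w n i) * population_mean f)
        \<longlonglongrightarrow> 0 + 1 * population_mean f"
      unfolding weighted_mean_def[symmetric] using total by (intro tendsto_intros)
    moreover have "weighted_mean n g \<omega> + (\<Sum>i=1..n. cluster_weight m w n i) * population_mean f =
        weighted_mean n f \<omega>" for n
      using weighted_mean_diff_const[of n f "population_mean f" \<omega>] by (simp add: g_def[abs_def])
    ultimately show ?case by simp
  qed
qed

text \<open>
  Each weight is bounded by the \<open>p\<close>-th root of the sum of the \<open>p\<close>-th powers, so the largest weight vanishes;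
  the sum of squares is at most the largest weight times the total weight.
\<close>
lemma sum_square_weights_tendsto_0:
  assumes total: "(\<lambda>n. \<Sum>i=1..n. cluster_weight m w n i) \<longlonglongrightarrow> 1"
    and p: "0 < p" and powers: "(\<lambda>n. \<Sum>i=1..n. cluster_weight m w n i powr p) \<longlonglongrightarrow> 0"
  shows "(\<lambda>n. \<Sum>i=1..n. (cluster_weight m w n i)\<^sup>2) \<longlonglongrightarrow> 0"
proof (rule tendsto_sandwich)
  let ?c = "cluster_weight m w"
  show "(\<lambda>_. 0) \<longlonglongrightarrow> (0::real)" by simp
  have c: "0 < ?c n i" if "i \<in> {1..n}" for n i
    using that cluster_weight_pos by simp
  have "(\<lambda>n. (\<Sum>i=1..n. ?c n i powr p) powr (1 / p) * (\<Sum>i=1..n. ?c n i)) \<longlonglongrightarrow> 0 powr (1 / p) * 1"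
    using powers total p
    by (intro tendsto_mult tendsto_powr2 tendsto_const) (auto simp: sum_nonneg)
  then show "(\<lambda>n. (\<Sum>i=1..n. ?c n i powr p) powr (1 / p) * (\<Sum>i=1..n. ?c n i)) \<longlonglongrightarrow> 0"
    by simp
  show "eventually (\<lambda>n. (\<Sum>i=1..n. (?c n i)\<^sup>2) \<le>
      (\<Sum>i=1..n. ?c n i powr p) powr (1 / p) * (\<Sum>i=1..n. ?c n i)) sequentially"
  proof (intro always_eventually allI)
    fix n
    have "?c n i \<le> (\<Sum>i=1..n. ?c n i powr p) powr (1 / p)" if "i \<in> {1..n}" for i
    proof -
      have "?c n i = (?c n i powr p) powr (1 / p)"
        using c[OF that] p by (simp add: powr_powr)
      also have "\<dots> \<le> (\<Sum>i=1..n. ?c n i powr p) powr (1 / p)"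
        using that p by (intro powr_mono2 member_le_sum) auto
      finally show ?thesis .
    qed
    then show "(\<Sum>i=1..n. (?c n i)\<^sup>2) \<le> (\<Sum>i=1..n. ?c n i powr p) powr (1 / p) * (\<Sum>i=1..n. ?c n i)"
      unfolding sum_distrib_left power2_eq_square
      using c by (intro sum_mono mult_right_mono) (auto intro: less_imp_le)
  qed
qed (auto intro!: always_eventually sum_nonneg)

end

section \<open>Consistency of the minimizer\<close>

definition hoelder_on :: "'a::real_normed_vector set \<Rightarrow> real \<Rightarrow> real \<Rightarrow> ('a \<Rightarrow> real) \<Rightarrow> bool" where
  "hoelder_on S lam H F \<longleftrightarrow> (\<forall>a\<in>S. \<forall>b\<in>S. \<bar>F a - F b\<bar> \<le> H * norm (a - b) powr lam)"

text \<open>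
  The net \<open>A\<close> and the tolerance \<open>\<tau>\<close> are chosen before the random criterion \<open>F\<close> is known: they depend only on the
  limit \<open>\<mu>\<close>. The Hoelder constant of \<open>F\<close> is allowed to vary as long as it stays below \<open>K + 1\<close>, hence the
  mesh is chosen for the combined constant \<open>2 * K + 1\<close> of \<open>F\<close> and \<open>\<mu>\<close>. Then \<open>F\<close> is within \<open>2 * \<tau>\<close> of \<open>\<mu>\<close> on all
  of \<open>\<Theta>\<close>, and a minimizer of \<open>F\<close> at distance at least \<open>\<epsilon>\<close> from \<open>\<theta>\<close> would contradict a gap of \<open>4 * \<tau>\<close>. As
  minimizers need not be unique, the conclusion is about each of them.
\<close>
lemma minimizer_near_of_finite_approximation:
  fixes \<Theta> :: "'a::euclidean_space set" and \<mu> :: "'a \<Rightarrow> real"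
  assumes \<Theta>: "bounded \<Theta>" "\<theta> \<in> \<Theta>" and lam: "0 < lam" and K: "0 \<le> K"
    and \<mu>: "hoelder_on \<Theta> lam K \<mu>"
    and gap: "0 < \<kappa>" "\<forall>a\<in>\<Theta>. \<epsilon> \<le> norm (a - \<theta>) \<longrightarrow> \<mu> \<theta> + \<kappa> \<le> \<mu> a"
  shows "\<exists>A \<tau>. finite A \<and> A \<subseteq> \<Theta> \<and> 0 < \<tau> \<and> (\<forall>F H t. H < K + 1 \<longrightarrow>
    hoelder_on \<Theta> lam H F \<longrightarrow> (\<forall>a\<in>A. \<bar>F a - \<mu> a\<bar> < \<tau>) \<longrightarrow> is_arg_min F (\<lambda>a. a \<in> \<Theta>) t \<longrightarrow> norm (t - \<theta>) < \<epsilon>)"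
proof -
  define \<tau> where "\<tau> = \<kappa> / 4"
  define \<eta> where "\<eta> = (\<tau> / (2 * K + 1)) powr (1 / lam)"
  have \<tau>: "0 < \<tau>" using gap by (simp add: \<tau>_def)
  then have \<eta>: "0 < \<eta>" using K by (simp add: \<eta>_def)
  have \<eta>_powr: "(2 * K + 1) * \<eta> powr lam = \<tau>"
    using lam \<tau> K by (simp add: \<eta>_def powr_powr)
  have "compact (closure \<Theta>)"
    using \<Theta> by simp
  then obtain A where A: "finite A" "A \<subseteq> \<Theta>" "closure \<Theta> \<subseteq> (\<Union>a\<in>A. ball a \<eta>)"
  proof (rule compactE_image[where C = \<Theta> and f = "\<lambda>a. ball a \<eta>"])
    show "closure \<Theta> \<subseteq> (\<Union>a\<in>\<Theta>. ball a \<eta>)"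
      using \<eta> by (auto simp: closure_approachable)
  qed auto
  have close: "norm (t - \<theta>) < \<epsilon>"
    if H: "H < K + 1"
      and F: "hoelder_on \<Theta> lam H F"
      and near: "\<forall>a\<in>A. \<bar>F a - \<mu> a\<bar> < \<tau>"
      and t: "is_arg_min F (\<lambda>a. a \<in> \<Theta>) t" for F H t
  proof (rule ccontr)
    have unif: "\<bar>F a - \<mu> a\<bar> < 2 * \<tau>" if a: "a \<in> \<Theta>" for a
    proof -
      obtain b where b: "b \<in> A" "dist b a < \<eta>"
        using subsetD[OF A(3) subsetD[OF closure_subset a]] by auto
      then have b': "b \<in> \<Theta>" using A by auto
      have "norm (a - b) powr lam \<le> \<eta> powr lam"
        using b lam by (intro powr_mono2) (auto simp: dist_norm norm_minus_commute)
      then have "(H + K) * norm (a - b) powr lam \<le> (2 * K + 1) * \<eta> powr lam"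
        using H K by (intro order_trans[OF mult_right_mono mult_left_mono]) auto
      then have "(H + K) * norm (a - b) powr lam \<le> \<tau>"
        by (simp only: \<eta>_powr)
      moreover have "\<bar>F a - F b\<bar> \<le> H * norm (a - b) powr lam" "\<bar>\<mu> a - \<mu> b\<bar> \<le> K * norm (a - b) powr lam"
        using F \<mu> a b' unfolding hoelder_on_def by blast+
      moreover have "\<bar>F b - \<mu> b\<bar> < \<tau>"
        using near b(1) by blast
      ultimately show ?thesis
        by (simp add: distrib_right)
    qed
    assume "\<not> norm (t - \<theta>) < \<epsilon>"
    moreover have t': "t \<in> \<Theta>" "F t \<le> F \<theta>"
      using t \<Theta> unfolding is_arg_min_def by (auto simp: not_less)
    ultimately have "\<mu> \<theta> + \<kappa> \<le> \<mu> t"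
      using gap(2) by auto
    then show False
      using unif[OF t'(1)] unif[OF \<Theta>(2)] t'(2) unfolding \<tau>_def by linarith
  qed
  show ?thesis
    by (intro exI[of _ A] exI[of _ \<tau>] conjI A(1,2) \<tau> allI impI) (rule close; blast)
qed

theorem theorem3p1:
  fixes M :: "'w measure"
    and P :: "real^'d \<Rightarrow> (real^'d) measure"
    and \<Theta> :: "(real^'d) set" and \<theta> :: "real^'d"
    and m :: "nat \<Rightarrow> nat"
    and X :: "nat \<Rightarrow> nat \<Rightarrow> 'w \<Rightarrow> real^'d"
    and \<l> :: real
    and w :: "nat \<Rightarrow> nat \<Rightarrow> real"
    and \<rho> :: "real^'d \<Rightarrow> real^'d \<Rightarrow> real"
    and T :: "nat \<Rightarrow> 'w \<Rightarrow> real^'d"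
    and \<delta> lam :: real
    and k :: "real^'d \<Rightarrow> real"
  assumes framework: "clustered_data M P \<Theta> \<theta> m X \<l>"
    and w_pos: "\<And>i j. i \<ge> 1 \<Longrightarrow> j \<in> {1..m i} \<Longrightarrow> w i j > 0"
    and rho_meas: "\<And>a. a \<in> \<Theta> \<Longrightarrow> (\<lambda>x. \<rho> x a) \<in> borel_measurable borel"
    and theta_argmin: "is_arg_min (\<lambda>a. \<integral>\<omega>. \<rho> (X 1 1 \<omega>) a \<partial>M) (\<lambda>a. a \<in> \<Theta>) \<theta>"
    and estimator: "weighted_M_estimator M \<Theta> \<rho> m w X T"
    and cond_a: "\<And>\<epsilon>::real. \<epsilon> > 0 \<Longrightarrow>
      (INF a\<in>{a\<in>\<Theta>. norm (a - \<theta>) \<ge> \<epsilon>}. ereal (\<integral>\<omega>. \<rho> (X 1 1 \<omega>) a \<partial>M))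
        > ereal (\<integral>\<omega>. \<rho> (X 1 1 \<omega>) \<theta> \<partial>M)"
    and cond_b: "(\<lambda>n. \<Sum>i=1..n. cluster_weight m w n i) \<longlonglongrightarrow> 1"
    and cond_c: "(SUP a\<in>\<Theta>. \<integral>\<^sup>+\<omega>. ennreal (\<bar>\<rho> (X 1 1 \<omega>) a\<bar> powr (1 + \<delta>)) \<partial>M) < \<infinity>"
    and cond_c_delta: "weight_cond_i m w \<delta> \<or> weight_cond_ii m w \<delta>"
    and lam: "0 < lam" "lam \<le> 1"
    and k_meas: "k \<in> borel_measurable borel"
    and k_nonneg: "\<And>x. k x \<ge> 0"
    and hoelder: "\<And>x a1 a2. a1 \<in> \<Theta> \<Longrightarrow> a2 \<in> \<Theta> \<Longrightarrow>
      \<bar>\<rho> x a1 - \<rho> x a2\<bar> \<le> k x * norm (a1 - a2) powr lam"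
    and k_moment: "(\<integral>\<^sup>+\<omega>. ennreal (k (X 1 1 \<omega>) powr (1 + \<delta>)) \<partial>M) < \<infinity>"
  shows "(weight_cond_i m w \<delta> \<longrightarrow> tendsto_in_probability M T \<theta>) \<and>
         (weight_cond_ii m w \<delta> \<longrightarrow> (AE \<omega> in M. (\<lambda>n. T n \<omega>) \<longlonglongrightarrow> \<theta>))"
proof -
  interpret weighted_clusters M P \<Theta> \<theta> m X \<l> w
    using framework w_pos by (intro weighted_clusters.intro weighted_clusters_axioms.intro)
  have X11 [measurable]: "X 1 1 \<in> borel_measurable M"
    using X_measurable first_index by blast
  note k_meas [measurable]
  have \<delta>: "0 < \<delta>"
    using cond_c_delta by (auto simp: weight_cond_i_def weight_cond_ii_def)

  define \<mu> where "\<mu> a = population_mean (\<lambda>x. \<rho> x a)" for a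
  define K where "K = population_mean k"
  have rho_mom: "integrable M (\<lambda>\<omega>. \<bar>\<rho> (X 1 1 \<omega>) a\<bar> powr (1 + \<delta>))" if a: "a \<in> \<Theta>" for a
  proof (rule integrableI_nonneg)
    show "(\<lambda>\<omega>. \<bar>\<rho> (X 1 1 \<omega>) a\<bar> powr (1 + \<delta>)) \<in> borel_measurable M"
      using rho_meas[OF a] by measurable
    show "(\<integral>\<^sup>+\<omega>. ennreal (\<bar>\<rho> (X 1 1 \<omega>) a\<bar> powr (1 + \<delta>)) \<partial>M) < \<infinity>"
      by (rule le_less_trans[OF SUP_upper[OF a] cond_c])
  qed simp
  have rho_int: "integrable M (\<lambda>\<omega>. \<rho> (X 1 1 \<omega>) a)" if a: "a \<in> \<Theta>" for a
    by (rule integrable_of_higher_moment[OF _ rho_mom[OF a]]) (use rho_meas[OF a] \<delta> in auto)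
  have k_mom: "integrable M (\<lambda>\<omega>. \<bar>k (X 1 1 \<omega>)\<bar> powr (1 + \<delta>))"
    using k_moment k_nonneg by (intro integrableI_nonneg) auto
  have k_int: "integrable M (\<lambda>\<omega>. k (X 1 1 \<omega>))"
    by (rule integrable_of_higher_moment[OF _ k_mom]) (use \<delta> in auto)
  have K: "0 \<le> K"
    unfolding K_def using k_nonneg by simp
  have \<mu>_hoelder: "hoelder_on \<Theta> lam K \<mu>"
    unfolding hoelder_on_def
  proof (intro ballI)
    fix a b assume that: "a \<in> \<Theta>" "b \<in> \<Theta>"
    have "\<mu> a - \<mu> b = expectation (\<lambda>\<omega>. \<rho> (X 1 1 \<omega>) a - \<rho> (X 1 1 \<omega>) b)"
      unfolding \<mu>_def using rho_int that by simp
    also have "\<bar>\<dots>\<bar> \<le> expectation (\<lambda>\<omega>. \<bar>\<rho> (X 1 1 \<omega>) a - \<rho> (X 1 1 \<omega>) b\<bar>)"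
      by (rule integral_abs_bound)
    also have "\<dots> \<le> expectation (\<lambda>\<omega>. k (X 1 1 \<omega>) * norm (a - b) powr lam)"
      using rho_int k_int hoelder that by (intro integral_mono) auto
    finally show "\<bar>\<mu> a - \<mu> b\<bar> \<le> K * norm (a - b) powr lam"
      unfolding K_def using k_int by simp
  qed

  \<comment> \<open>Reduces consistency to the laws of large numbers for finitely many functions.\<close>
  have key: "\<exists>A \<tau>. finite A \<and> A \<subseteq> \<Theta> \<and> 0 < \<tau> \<and> (\<forall>n\<ge>1. \<forall>\<omega>\<in>space M.
      \<bar>weighted_mean n k \<omega> - K\<bar> < 1 \<longrightarrow> (\<forall>a\<in>A. \<bar>weighted_mean n (\<lambda>x. \<rho> x a) \<omega> - \<mu> a\<bar> < \<tau>) \<longrightarrow>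
      dist (T n \<omega>) \<theta> < \<epsilon>)" if \<epsilon>: "0 < \<epsilon>" for \<epsilon>
  proof -
    \<comment> \<open>Beyond distance \<open>\<epsilon>\<close> from \<open>\<theta>\<close> there may be no parameter at all, and the infimum is then infinite; a real number below it serves in both cases.\<close>
    obtain c where c: "ereal (\<mu> \<theta>) < ereal c"
      "ereal c < (INF a\<in>{a\<in>\<Theta>. \<epsilon> \<le> norm (a - \<theta>)}. ereal (\<mu> a))"
      using ereal_dense2[OF cond_a[OF \<epsilon>]] unfolding \<mu>_def by blast
    have gap: "\<forall>a\<in>\<Theta>. \<epsilon> \<le> norm (a - \<theta>) \<longrightarrow> \<mu> \<theta> + (c - \<mu> \<theta>) \<le> \<mu> a"
    proof (intro ballI impI)
      fix a assume "a \<in> \<Theta>" "\<epsilon> \<le> norm (a - \<theta>)"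
      then show "\<mu> \<theta> + (c - \<mu> \<theta>) \<le> \<mu> a"
        using less_le_trans[OF c(2) INF_lower[of a]] by simp
    qed
    have pos: "0 < c - \<mu> \<theta>" using c(1) by simp
    obtain A \<tau> where A: "finite A" "A \<subseteq> \<Theta>" "0 < \<tau>"
      and close: "\<forall>F H t. H < K + 1 \<longrightarrow> hoelder_on \<Theta> lam H F \<longrightarrow>
        (\<forall>a\<in>A. \<bar>F a - \<mu> a\<bar> < \<tau>) \<longrightarrow> is_arg_min F (\<lambda>a. a \<in> \<Theta>) t \<longrightarrow> norm (t - \<theta>) < \<epsilon>"
      using minimizer_near_of_finite_approximation[OF bounded_Theta theta_in lam(1) K \<mu>_hoelder pos gap]
      by blast
    have "dist (T n \<omega>) \<theta> < \<epsilon>"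
      if n: "1 \<le> n" and \<omega>: "\<omega> \<in> space M" and k_close: "\<bar>weighted_mean n k \<omega> - K\<bar> < 1"
        and A_close: "\<forall>a\<in>A. \<bar>weighted_mean n (\<lambda>x. \<rho> x a) \<omega> - \<mu> a\<bar> < \<tau>" for n \<omega>
      unfolding dist_norm
    proof (rule close[rule_format])
      show "weighted_mean n k \<omega> < K + 1"
        using k_close by simp
      show "is_arg_min (\<lambda>a. weighted_mean n (\<lambda>x. \<rho> x a) \<omega>) (\<lambda>a. a \<in> \<Theta>) (T n \<omega>)"
        using estimator n \<omega> unfolding weighted_M_estimator_def weighted_criterion_eq_weighted_mean[abs_def]
        by blast
      show "hoelder_on \<Theta> lam (weighted_mean n k \<omega>) (\<lambda>a. weighted_mean n (\<lambda>x. \<rho> x a) \<omega>)"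
        unfolding hoelder_on_def
        using weighted_mean_abs_diff_le[of "\<lambda>x. \<rho> x a" "\<lambda>x. \<rho> x b" "norm (a - b) powr lam" k for a b] hoelder
        by (simp add: mult.commute)
    qed (use A_close in auto)
    with A show ?thesis by blast
  qed

  have in_prob: "tendsto_in_probability M T \<theta>" if cond: "weight_cond_i m w \<delta>"
    unfolding tendsto_in_probability_def
  proof (intro allI impI)
    fix \<epsilon> :: real assume \<epsilon>: "0 < \<epsilon>"
    have squares: "(\<lambda>n. \<Sum>i=1..n. (cluster_weight m w n i)\<^sup>2) \<longlonglongrightarrow> 0"
      using cond \<delta> cond_b by (intro sum_square_weights_tendsto_0[of "1 + \<delta>"]) (auto simp: weight_cond_i_def)
    obtain A \<tau> where A: "finite A" "A \<subseteq> \<Theta>" "0 < \<tau>"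
      and close: "\<And>n \<omega>. 1 \<le> n \<Longrightarrow> \<omega> \<in> space M \<Longrightarrow> \<bar>weighted_mean n k \<omega> - K\<bar> < 1 \<Longrightarrow>
        \<forall>a\<in>A. \<bar>weighted_mean n (\<lambda>x. \<rho> x a) \<omega> - \<mu> a\<bar> < \<tau> \<Longrightarrow> dist (T n \<omega>) \<theta> < \<epsilon>"
      using key[OF \<epsilon>] by blast
    define bad_k where "bad_k n = {\<omega>\<in>space M. 1 \<le> \<bar>weighted_mean n k \<omega> - K\<bar>}" for n
    define bad where "bad a n = {\<omega>\<in>space M. \<tau> \<le> \<bar>weighted_mean n (\<lambda>x. \<rho> x a) \<omega> - \<mu> a\<bar>}" for a n
    have bad_k_sets: "bad_k n \<in> events" for n
      using weighted_mean_measurable[OF k_meas] unfolding bad_k_def by measurable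
    have bad_sets: "bad a n \<in> events" if "a \<in> A" for a n
    proof -
      have [measurable]: "weighted_mean n (\<lambda>x. \<rho> x a) \<in> borel_measurable M"
        using that A(2) by (intro weighted_mean_measurable rho_meas) auto
      show ?thesis unfolding bad_def by measurable
    qed
    have "(\<lambda>n. prob (bad_k n) + (\<Sum>a\<in>A. prob (bad a n))) \<longlonglongrightarrow> 0 + (\<Sum>a\<in>A. 0)"
      unfolding bad_k_def bad_def K_def \<mu>_def using A rho_meas rho_int k_meas k_int
      by (intro tendsto_add tendsto_sum weighted_mean_prob_law cond_b squares) auto
    then have lim: "(\<lambda>n. prob (bad_k n) + (\<Sum>a\<in>A. prob (bad a n))) \<longlonglongrightarrow> 0" by simp
    have "eventually (\<lambda>n. prob {\<omega>\<in>space M. \<epsilon> < dist (T n \<omega>) \<theta>} \<le>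
        prob (bad_k n) + (\<Sum>a\<in>A. prob (bad a n))) sequentially"
      using eventually_ge_at_top[of 1]
    proof eventually_elim
      case (elim n)
      have "prob {\<omega>\<in>space M. \<epsilon> < dist (T n \<omega>) \<theta>} \<le> prob (bad_k n \<union> (\<Union>a\<in>A. bad a n))"
      proof (intro finite_measure_mono subsetI)
        fix \<omega> assume "\<omega> \<in> {\<omega>\<in>space M. \<epsilon> < dist (T n \<omega>) \<theta>}"
        then show "\<omega> \<in> bad_k n \<union> (\<Union>a\<in>A. bad a n)"
          using close[OF elim, of \<omega>] by (fastforce simp: bad_k_def bad_def not_less)
      qed (intro sets.Un sets.finite_UN A(1) bad_k_sets bad_sets)
      also have "\<dots> \<le> prob (bad_k n) + prob (\<Union>a\<in>A. bad a n)"
        by (intro measure_Un_le sets.finite_UN A(1) bad_k_sets bad_sets)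
      also have "prob (\<Union>a\<in>A. bad a n) \<le> (\<Sum>a\<in>A. prob (bad a n))"
        using A bad_sets by (intro finite_measure_subadditive_finite) auto
      finally show ?case by simp
    qed
    then show "(\<lambda>n. prob {\<omega>\<in>space M. dist (T n \<omega>) \<theta> > \<epsilon>}) \<longlonglongrightarrow> 0"
      by (intro tendsto_sandwich[OF _ _ tendsto_const lim]) auto
  qed

  have almost_surely: "AE \<omega> in M. (\<lambda>n. T n \<omega>) \<longlonglongrightarrow> \<theta>" if cond: "weight_cond_ii m w \<delta>"
  proof -
    obtain s where cond': "1 < \<delta>" "summable (\<lambda>n. \<Sum>i=1..n. cluster_weight m w n i powr (1 + \<delta>))"
      "0 < s" "summable (\<lambda>n. (\<Sum>i=1..n. (cluster_weight m w n i)\<^sup>2) powr s)"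
      using cond unfolding weight_cond_ii_def by blast
    have p: "2 \<le> 1 + \<delta>" using cond'(1) by simp
    note strong_law = weighted_mean_strong_law[OF cond_b p cond'(2-4)]
    have "AE \<omega> in M. eventually (\<lambda>n. dist (T n \<omega>) \<theta> < \<epsilon>) sequentially" if \<epsilon>: "0 < \<epsilon>" for \<epsilon>
    proof -
      obtain A \<tau> where A: "finite A" "A \<subseteq> \<Theta>" "0 < \<tau>"
        and close: "\<And>n \<omega>. 1 \<le> n \<Longrightarrow> \<omega> \<in> space M \<Longrightarrow> \<bar>weighted_mean n k \<omega> - K\<bar> < 1 \<Longrightarrow>
          \<forall>a\<in>A. \<bar>weighted_mean n (\<lambda>x. \<rho> x a) \<omega> - \<mu> a\<bar> < \<tau> \<Longrightarrow> dist (T n \<omega>) \<theta> < \<epsilon>"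
        using key[OF \<epsilon>] by blast
      have "AE \<omega> in M. \<forall>a\<in>A. (\<lambda>n. weighted_mean n (\<lambda>x. \<rho> x a) \<omega>) \<longlonglongrightarrow> \<mu> a"
        unfolding \<mu>_def using A rho_meas rho_mom by (intro AE_finite_allI strong_law) auto
      moreover have "AE \<omega> in M. (\<lambda>n. weighted_mean n k \<omega>) \<longlonglongrightarrow> K"
        unfolding K_def by (rule strong_law[OF k_meas k_mom])
      ultimately show ?thesis
        using AE_space
      proof eventually_elim
        case (elim \<omega>)
        have "eventually (\<lambda>n. \<forall>a\<in>A. \<bar>weighted_mean n (\<lambda>x. \<rho> x a) \<omega> - \<mu> a\<bar> < \<tau>) sequentially"
          using elim(1) A by (intro eventually_ball_finite) (auto dest!: tendstoD simp: dist_real_def)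
        moreover have "eventually (\<lambda>n. \<bar>weighted_mean n k \<omega> - K\<bar> < 1) sequentially"
          using tendstoD[OF elim(2), of 1] by (simp add: dist_real_def)
        ultimately show ?case
          using eventually_ge_at_top[of 1] by eventually_elim (use close elim(3) in blast)
      qed
    qed
    then show ?thesis
      by (rule AE_tendsto_of_AE_eventually_close)
  qed
  show ?thesis using in_prob almost_surely by blast
qed

end
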